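(* Let $c\in\{1,-1\}$ and let $f\colon M^n\to\mathbb{Q}^n_c\times\mathbb{R}$, $n\ge 2$, be a non umbilical hypersurface having constant principal curvatures with constant multiplicities, and suppose that its function $\nu$ satisfies $\nu(p)\neq 0$ for all $p\in M^n$. Then $f$ has at least one principal curvature of multiplicity one.
   Context: $\mathbb{Q}^n_c$ denotes the unit sphere $\mathbb{S}^n$ if $c=1$ and the hyperbolic space $\mathbb{H}^n$ (curvature $-1$) if $c=-1$. A hypersurface $f\colon M^n\to\mathbb{Q}^n_c\times\mathbb{R}$ is an isometric immersion of a (connected) Riemannian $n$-manifold with unit normal field $\eta$ and shape operator $A$; principal curvatures are the eigenvalues of $A$. With $\partial/\partial t$ the unit vector field tangent to the factor $\mathbb{R}$, the tangent vector field $T$ on $M^n$ and the smooth function $\nu$ are defined by $\partial/\partial t=df(T)+\nu\eta$. Non umbilical means that the number of distinct (constant) principal curvatures is at least $2$. *)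

theory Defs
  imports "HOL-Analysis.Analysis"
begin

section \<open>Smooth maps between normed spaces\<close>

text \<open>Meant for open \<open>S\<close> (derivatives are taken in a full neighbourhood): all iterated
  directional derivatives exist as Frechet derivatives and are continuous.\<close>

primrec higher_differentiable_on ::
    "'a::real_normed_vector set \<Rightarrow> ('a \<Rightarrow> 'b::real_normed_vector) \<Rightarrow> nat \<Rightarrow> bool" where
  "higher_differentiable_on S f 0 \<longleftrightarrow> continuous_on S f"
| "higher_differentiable_on S f (Suc k) \<longleftrightarrow>
     (\<forall>x\<in>S. f differentiable (at x)) \<and>
     (\<forall>v. higher_differentiable_on S (\<lambda>x. frechet_derivative f (at x) v) k)"

definition smooth_on ::
    "'a::real_normed_vector set \<Rightarrow> ('a \<Rightarrow> 'b::real_normed_vector) \<Rightarrow> bool" where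
  "smooth_on S f \<longleftrightarrow> (\<forall>k. higher_differentiable_on S f k)"


section \<open>Smooth manifolds of dimension \<open>CARD('n)\<close>\<close>

type_synonym ('m, 'n) chart = "'m set \<times> ('m \<Rightarrow> real ^ 'n)"

abbreviation chart_dom :: "('m, 'n) chart \<Rightarrow> 'm set" where
  "chart_dom a \<equiv> fst a"

abbreviation chart_map :: "('m, 'n) chart \<Rightarrow> 'm \<Rightarrow> real ^ 'n" where
  "chart_map a \<equiv> snd a"

definition chart_inv :: "('m, 'n) chart \<Rightarrow> real ^ 'n \<Rightarrow> 'm" where
  "chart_inv a = inv_into (chart_dom a) (chart_map a)"

definition is_chart :: "'m topology \<Rightarrow> ('m, 'n::finite) chart \<Rightarrow> bool" where
  "is_chart X a \<longleftrightarrow> openin X (chart_dom a) \<and> open (chart_map a ` chart_dom a) \<and>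
     homeomorphic_map (subtopology X (chart_dom a)) (top_of_set (chart_map a ` chart_dom a))
       (chart_map a)"

definition smooth_atlas :: "'m topology \<Rightarrow> ('m, 'n::finite) chart set \<Rightarrow> bool" where
  "smooth_atlas X \<A> \<longleftrightarrow> (\<forall>a\<in>\<A>. is_chart X a) \<and> (\<Union>a\<in>\<A>. chart_dom a) = topspace X \<and>
     (\<forall>a\<in>\<A>. \<forall>b\<in>\<A>. smooth_on (chart_map a ` (chart_dom a \<inter> chart_dom b))
                        (chart_map b \<circ> chart_inv a))"

definition connected_smooth_manifold :: "'m topology \<Rightarrow> ('m, 'n::finite) chart set \<Rightarrow> bool" where
  "connected_smooth_manifold X \<A> \<longleftrightarrow>
     Hausdorff_space X \<and> second_countable X \<and> connected_space X \<and> topspace X \<noteq> {} \<and>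
     smooth_atlas X \<A>"

definition smooth_map :: "('m, 'n::finite) chart set \<Rightarrow> ('m \<Rightarrow> 'b::real_normed_vector) \<Rightarrow> bool" where
  "smooth_map \<A> h \<longleftrightarrow> (\<forall>a\<in>\<A>. smooth_on (chart_map a ` chart_dom a) (h \<circ> chart_inv a))"

text \<open>Every point \<open>p\<close> gets a preferred chart of the atlas around it, and the tangent space
  at \<open>p\<close> is \<open>real ^ 'n\<close>, a vector being represented by its components in that chart.
  Nothing depends on the choice up to linear isomorphism of each tangent space.\<close>

definition chart_at :: "('m, 'n::finite) chart set \<Rightarrow> 'm \<Rightarrow> ('m, 'n) chart" where
  "chart_at \<A> p = (SOME a. a \<in> \<A> \<and> p \<in> chart_dom a)"

definition differential ::
    "('m, 'n::finite) chart set \<Rightarrow> ('m \<Rightarrow> 'b::real_normed_vector) \<Rightarrow> 'm \<Rightarrow> real ^ 'n \<Rightarrow> 'b" where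
  "differential \<A> h p =
     frechet_derivative (h \<circ> chart_inv (chart_at \<A> p)) (at (chart_map (chart_at \<A> p) p))"

text \<open>The tangent vector at \<open>p\<close> whose components in the chart \<open>a\<close> (not necessarily the
  preferred one) are \<open>u\<close>.\<close>

definition coord_vector ::
    "('m, 'n::finite) chart set \<Rightarrow> ('m, 'n) chart \<Rightarrow> 'm \<Rightarrow> real ^ 'n \<Rightarrow> real ^ 'n" where
  "coord_vector \<A> a p u =
     frechet_derivative (chart_map (chart_at \<A> p) \<circ> chart_inv a) (at (chart_map a p)) u"

definition riemannian_metric ::
    "'m topology \<Rightarrow> ('m, 'n::finite) chart set \<Rightarrow> ('m \<Rightarrow> real ^ 'n \<Rightarrow> real ^ 'n \<Rightarrow> real) \<Rightarrow> bool" where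
  "riemannian_metric X \<A> g \<longleftrightarrow>
     (\<forall>p\<in>topspace X. bilinear (g p) \<and> (\<forall>u v. g p u v = g p v u) \<and> (\<forall>v. v \<noteq> 0 \<longrightarrow> 0 < g p v v)) \<and>
     (\<forall>a\<in>\<A>. \<forall>u v. smooth_on (chart_map a ` chart_dom a)
        (\<lambda>x. g (chart_inv a x) (coord_vector \<A> a (chart_inv a x) u)
                                (coord_vector \<A> a (chart_inv a x) v)))"


section \<open>The ambient space \<open>Q\<^sup>n\<^sub>c \<times> \<real>\<close>\<close>

text \<open>\<open>Q\<^sup>n\<^sub>c\<close> lies in \<open>\<real>\<^sup>n\<^sup>+\<^sup>1\<close>, written as \<open>\<real> \<times> \<real>\<^sup>n\<close> with the inner product
  \<open>c x\<^sub>0 y\<^sub>0 + x\<^sub>1 y\<^sub>1 + \<dots> + x\<^sub>n y\<^sub>n\<close>: Euclidean for \<open>c = 1\<close>, Lorentzian for \<open>c = -1\<close>.\<close>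

type_synonym 'n ambient = "(real \<times> (real ^ 'n)) \<times> real"

definition qform :: "real \<Rightarrow> real \<times> (real ^ 'n::finite) \<Rightarrow> real \<times> (real ^ 'n) \<Rightarrow> real" where
  "qform c x y = c * fst x * fst y + snd x \<bullet> snd y"

text \<open>The unit sphere for \<open>c = 1\<close>, the upper sheet of the hyperboloid for \<open>c = -1\<close>.\<close>

definition space_form :: "real \<Rightarrow> (real \<times> (real ^ 'n::finite)) set" where
  "space_form c = {x. qform c x x = c \<and> (c = -1 \<longrightarrow> 0 < fst x)}"

definition ambient_metric :: "real \<Rightarrow> 'n::finite ambient \<Rightarrow> 'n ambient \<Rightarrow> real" where
  "ambient_metric c v w = qform c (fst v) (fst w) + snd v * snd w"

text \<open>Tangent space of \<open>Q\<^sup>n\<^sub>c \<times> \<real>\<close> at \<open>y = (x, t)\<close>; the position vector \<open>x\<close> is normal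
  to \<open>Q\<^sup>n\<^sub>c\<close>.\<close>

definition ambient_tangent :: "real \<Rightarrow> 'n::finite ambient \<Rightarrow> 'n ambient set" where
  "ambient_tangent c y = {w. qform c (fst y) (fst w) = 0}"

text \<open>Orthogonal projection onto that tangent space. As \<open>\<langle>x, x\<rangle> = c = 1/c\<close>, the normal
  component of \<open>w\<close> is \<open>c \<langle>x, w\<rangle> x\<close>.\<close>

definition tangent_proj :: "real \<Rightarrow> 'n::finite ambient \<Rightarrow> 'n ambient \<Rightarrow> 'n ambient" where
  "tangent_proj c y w = w - (c * qform c (fst y) (fst w)) *\<^sub>R (fst y, 0)"

definition vertical_field :: "'n::finite ambient" where
  "vertical_field = ((0, 0), 1)"


section \<open>Hypersurfaces\<close>

definition isometric_immersion ::
    "real \<Rightarrow> 'm topology \<Rightarrow> ('m, 'n::finite) chart set \<Rightarrow> ('m \<Rightarrow> real ^ 'n \<Rightarrow> real ^ 'n \<Rightarrow> real)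
      \<Rightarrow> ('m \<Rightarrow> 'n ambient) \<Rightarrow> bool" where
  "isometric_immersion c X \<A> g f \<longleftrightarrow>
     smooth_map \<A> f \<and>
     (\<forall>p\<in>topspace X. f p \<in> space_form c \<times> UNIV) \<and>
     (\<forall>p\<in>topspace X. \<forall>u v.
        ambient_metric c (differential \<A> f p u) (differential \<A> f p v) = g p u v)"

definition unit_normal_field ::
    "real \<Rightarrow> 'm topology \<Rightarrow> ('m, 'n::finite) chart set \<Rightarrow> ('m \<Rightarrow> 'n ambient)
      \<Rightarrow> ('m \<Rightarrow> 'n ambient) \<Rightarrow> bool" where
  "unit_normal_field c X \<A> f \<eta> \<longleftrightarrow>
     smooth_map \<A> \<eta> \<and>
     (\<forall>p\<in>topspace X. \<eta> p \<in> ambient_tangent c (f p) \<and>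
        ambient_metric c (\<eta> p) (\<eta> p) = 1 \<and>
        (\<forall>v. ambient_metric c (\<eta> p) (differential \<A> f p v) = 0))"

definition hypersurface ::
    "real \<Rightarrow> 'm topology \<Rightarrow> ('m, 'n::finite) chart set \<Rightarrow> ('m \<Rightarrow> real ^ 'n \<Rightarrow> real ^ 'n \<Rightarrow> real)
      \<Rightarrow> ('m \<Rightarrow> 'n ambient) \<Rightarrow> ('m \<Rightarrow> 'n ambient) \<Rightarrow> bool" where
  "hypersurface c X \<A> g f \<eta> \<longleftrightarrow>
     connected_smooth_manifold X \<A> \<and> riemannian_metric X \<A> g \<and>
     isometric_immersion c X \<A> g f \<and> unit_normal_field c X \<A> f \<eta>"

text \<open>Covariant derivative along \<open>f\<close>, in the direction \<open>v\<close> at \<open>p\<close>, of a field \<open>V\<close> tangent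
  to \<open>Q\<^sup>n\<^sub>c \<times> \<real>\<close>. By the Gauss formula the Levi-Civita connection of \<open>Q\<^sup>n\<^sub>c \<times> \<real>\<close> is the
  tangential part of the flat derivative of \<open>\<real>\<^sup>n\<^sup>+\<^sup>1 \<times> \<real>\<close>.\<close>

definition covariant_derivative ::
    "real \<Rightarrow> ('m, 'n::finite) chart set \<Rightarrow> ('m \<Rightarrow> 'n ambient) \<Rightarrow> ('m \<Rightarrow> 'n ambient)
      \<Rightarrow> 'm \<Rightarrow> real ^ 'n \<Rightarrow> 'n ambient" where
  "covariant_derivative c \<A> f V p v = tangent_proj c (f p) (differential \<A> V p v)"

text \<open>As \<open>df\<close> is injective, the Weingarten formula determines \<open>A\<close> on \<open>topspace X\<close>.\<close>

definition is_shape_operator ::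
    "real \<Rightarrow> 'm topology \<Rightarrow> ('m, 'n::finite) chart set \<Rightarrow> ('m \<Rightarrow> 'n ambient)
      \<Rightarrow> ('m \<Rightarrow> 'n ambient) \<Rightarrow> ('m \<Rightarrow> real ^ 'n \<Rightarrow> real ^ 'n) \<Rightarrow> bool" where
  "is_shape_operator c X \<A> f \<eta> A \<longleftrightarrow>
     (\<forall>p\<in>topspace X. \<forall>v. differential \<A> f p (A p v) = - covariant_derivative c \<A> f \<eta> p v)"

definition principal_curvatures :: "('m \<Rightarrow> real ^ 'n \<Rightarrow> real ^ 'n) \<Rightarrow> 'm \<Rightarrow> real set" where
  "principal_curvatures A p = {l. \<exists>v. v \<noteq> 0 \<and> A p v = l *\<^sub>R v}"

text \<open>The shape operator is self-adjoint, so algebraic and geometric multiplicities of its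
  eigenvalues agree.\<close>

definition pc_multiplicity :: "('m \<Rightarrow> real ^ 'n::finite \<Rightarrow> real ^ 'n) \<Rightarrow> 'm \<Rightarrow> real \<Rightarrow> nat" where
  "pc_multiplicity A p l = dim {v. A p v = l *\<^sub>R v}"

definition constant_principal_curvatures ::
    "'m topology \<Rightarrow> ('m \<Rightarrow> real ^ 'n::finite \<Rightarrow> real ^ 'n) \<Rightarrow> bool" where
  "constant_principal_curvatures X A \<longleftrightarrow>
     (\<forall>p\<in>topspace X. \<forall>q\<in>topspace X. principal_curvatures A p = principal_curvatures A q \<and>
        (\<forall>l\<in>principal_curvatures A p. pc_multiplicity A p l = pc_multiplicity A q l))"

definition non_umbilical ::
    "'m topology \<Rightarrow> ('m \<Rightarrow> real ^ 'n::finite \<Rightarrow> real ^ 'n) \<Rightarrow> bool" where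
  "non_umbilical X A \<longleftrightarrow> (\<forall>p\<in>topspace X. 2 \<le> card (principal_curvatures A p))"

text \<open>\<open>\<partial>/\<partial>t = df(T) + \<nu> \<eta>\<close> determines \<open>T\<close> and \<open>\<nu>\<close> on \<open>topspace X\<close>.\<close>

definition vertical_decomposition ::
    "'m topology \<Rightarrow> ('m, 'n::finite) chart set \<Rightarrow> ('m \<Rightarrow> 'n ambient) \<Rightarrow> ('m \<Rightarrow> 'n ambient)
      \<Rightarrow> ('m \<Rightarrow> real ^ 'n) \<Rightarrow> ('m \<Rightarrow> real) \<Rightarrow> bool" where
  "vertical_decomposition X \<A> f \<eta> T \<nu> \<longleftrightarrow>
     (\<forall>p\<in>topspace X. vertical_field = differential \<A> f p (T p) + \<nu> p *\<^sub>R \<eta> p)"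

end

theory Submission
  imports Defs
begin

text \<open>For a constant eigenvalue \<open>l\<close> whose eigenspaces have constant dimension, the component of
  \<open>(\<nabla>\<^sub>u A) v\<close> in the eigenspace vanishes for eigenvectors \<open>u\<close>, \<open>v\<close>. The Codazzi equation then gives
  \<open>\<langle>v, T\<rangle> u = \<langle>u, T\<rangle> v\<close> on the eigenspace wherever \<open>\<nu> \<noteq> 0\<close>, so \<open>T\<close> is orthogonal to every eigenspace of
  dimension at least two. If no principal curvature is simple, \<open>T\<close> is orthogonal to all eigenvectors
  of the self-adjoint \<open>A\<close>, whence \<open>T = 0\<close>; then \<open>\<eta>\<close> is vertical and of unit length, so it is parallel
  and \<open>A = 0\<close>, contradicting that there are two principal curvatures.

  Smooth eigenvector fields are avoided: only the derivatives of the bilinear forms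
  \<open>\<langle>(l - A) v, w\<rangle>\<close> in a chart are used.\<close>

section \<open>Symmetry of second derivatives\<close>

text \<open>The mean value theorem is used twice: in direction \<open>v\<close> for the increment
  \<open>P\<close>, then in direction \<open>w\<close> for the derivative along \<open>v\<close>.
  The left-hand side is symmetric in \<open>v\<close> and \<open>w\<close>, so the lemma can be
  applied with both orders of differentiation.\<close>

lemma second_difference_mvt:
  fixes u :: "'a::real_normed_vector \<Rightarrow> real"
  assumes h: "0 < h"
    and in_U: "\<And>s t. \<lbrakk>0 \<le> s; s \<le> h; 0 \<le> t; t \<le> h\<rbrakk> \<Longrightarrow> x + s *\<^sub>R v + t *\<^sub>R w \<in> U"
    and du: "\<And>y. y \<in> U \<Longrightarrow> (u has_derivative u' y) (at y)"
    and ddu: "\<And>y. y \<in> U \<Longrightarrow> ((\<lambda>y. u' y v) has_derivative u'' y) (at y)"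
  obtains s t where "0 \<le> s" "s \<le> h" "0 \<le> t" "t \<le> h"
    "u (x + h *\<^sub>R v + h *\<^sub>R w) - u (x + h *\<^sub>R v) - u (x + h *\<^sub>R w) + u x
      = h * h * u'' (x + s *\<^sub>R v + t *\<^sub>R w) w"
proof -
  define P where "P s = u (x + s *\<^sub>R v + h *\<^sub>R w) - u (x + s *\<^sub>R v)" for s
  have dP: "(P has_derivative (\<lambda>k. u' (x + s *\<^sub>R v + h *\<^sub>R w) (k *\<^sub>R v) - u' (x + s *\<^sub>R v) (k *\<^sub>R v))) (at s)"
    if "0 \<le> s" "s \<le> h" for s
  proof -
    have 1: "x + s *\<^sub>R v + h *\<^sub>R w \<in> U" "x + s *\<^sub>R v \<in> U"
      using in_U[of s h] in_U[of s 0] that h by auto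
    show ?thesis unfolding P_def
      by (rule has_derivative_diff; rule has_derivative_compose[where g=u, OF _ du])
        (auto intro!: derivative_eq_intros simp: 1)
  qed
  obtain s where s: "0 < s" "s < h" "P h - P 0 = h * (u' (x + s *\<^sub>R v + h *\<^sub>R w) v - u' (x + s *\<^sub>R v) v)"
  proof -
    obtain s where s: "s \<in> {0<..<h}"
      "P h - P 0 = (\<lambda>k. u' (x + s *\<^sub>R v + h *\<^sub>R w) (k *\<^sub>R v) - u' (x + s *\<^sub>R v) (k *\<^sub>R v)) (h - 0)"
      using mvt_simple[OF h has_derivative_at_withinI[OF dP]] by blast
    have "x + s *\<^sub>R v + h *\<^sub>R w \<in> U" "x + s *\<^sub>R v \<in> U"
      using in_U[of s h] in_U[of s 0] s h by auto
    then have "linear (u' (x + s *\<^sub>R v + h *\<^sub>R w))" "linear (u' (x + s *\<^sub>R v))"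
      using du has_derivative_linear by blast+
    then show ?thesis using s that by (auto simp: linear_scale algebra_simps)
  qed
  define R where "R t = u' (x + s *\<^sub>R v + t *\<^sub>R w) v" for t
  have in_U2: "x + s *\<^sub>R v + t *\<^sub>R w \<in> U" if "0 \<le> t" "t \<le> h" for t
    using in_U[of s t] s that by auto
  have dR: "(R has_derivative (\<lambda>k. u'' (x + s *\<^sub>R v + t *\<^sub>R w) (k *\<^sub>R w))) (at t)"
    if "0 \<le> t" "t \<le> h" for t
    unfolding R_def
    by (rule has_derivative_compose[where g="\<lambda>y. u' y v", OF _ ddu])
      (auto intro!: derivative_eq_intros simp: in_U2 that)
  obtain t where t: "t \<in> {0<..<h}"
      "R h - R 0 = (\<lambda>k. u'' (x + s *\<^sub>R v + t *\<^sub>R w) (k *\<^sub>R w)) (h - 0)"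
    using mvt_simple[OF h has_derivative_at_withinI[OF dR]] by blast
  have "linear (u'' (x + s *\<^sub>R v + t *\<^sub>R w))"
    using t by (intro has_derivative_linear[OF ddu] in_U2) auto
  then have "P h - P 0 = h * (h * u'' (x + s *\<^sub>R v + t *\<^sub>R w) w)"
    using s t by (simp add: R_def linear_scale)
  then show ?thesis
    using s t that[of s t] by (auto simp: P_def algebra_simps)
qed

text \<open>The same second difference is \<open>h * h\<close> times either mixed derivative, each
  at some point close to \<open>x\<close>. Continuity at \<open>x\<close> then rules out a gap
  between the two values.\<close>

lemma mixed_derivatives_eq_real:
  fixes u :: "'a::real_normed_vector \<Rightarrow> real"
  assumes U: "open U" "x \<in> U"
    and du: "\<And>y. y \<in> U \<Longrightarrow> (u has_derivative u' y) (at y)"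
    and ddv: "\<And>y. y \<in> U \<Longrightarrow> ((\<lambda>y. u' y v) has_derivative uv y) (at y)"
    and ddw: "\<And>y. y \<in> U \<Longrightarrow> ((\<lambda>y. u' y w) has_derivative uw y) (at y)"
    and cont: "isCont (\<lambda>y. uv y w) x" "isCont (\<lambda>y. uw y v) x"
  shows "uv x w = uw x v"
proof (rule ccontr)
  assume ne: "uv x w \<noteq> uw x v"
  define e where "e = \<bar>uv x w - uw x v\<bar> / 2"
  have "e > 0" using ne by (simp add: e_def)
  obtain d0 where d0: "d0 > 0" "\<And>y. dist y x < d0 \<Longrightarrow> y \<in> U"
    using U open_dist by blast
  obtain d1 where d1: "d1 > 0" "\<And>y. dist y x < d1 \<Longrightarrow> dist (uv y w) (uv x w) < e"
    using cont(1) \<open>e > 0\<close> unfolding continuous_at_eps_delta by (metis dist_norm)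
  obtain d2 where d2: "d2 > 0" "\<And>y. dist y x < d2 \<Longrightarrow> dist (uw y v) (uw x v) < e"
    using cont(2) \<open>e > 0\<close> unfolding continuous_at_eps_delta by (metis dist_norm)
  define d where "d = min d0 (min d1 d2)"
  have "d > 0" using d0 d1 d2 by (simp add: d_def)
  \<comment> \<open>This keeps the whole parallelogram with sides \<open>h *\<^sub>R v\<close> and
    \<open>h *\<^sub>R w\<close> within distance \<open>d\<close> of \<open>x\<close>; the summand 1
    covers \<open>v = w = 0\<close>.\<close>
  define h where "h = d / (norm v + norm w + 1)"
  have pos: "norm v + norm w + 1 > 0" by (smt (verit) norm_ge_zero)
  have h: "h > 0" using pos \<open>d > 0\<close> by (simp add: h_def)
  have near: "dist (x + s *\<^sub>R v + t *\<^sub>R w) x < d" if "0 \<le> s" "s \<le> h" "0 \<le> t" "t \<le> h" for s t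
  proof -
    have "dist (x + s *\<^sub>R v + t *\<^sub>R w) x = norm (s *\<^sub>R v + t *\<^sub>R w)"
      by (simp add: dist_norm)
    also have "\<dots> \<le> s * norm v + t * norm w"
      using norm_triangle_ineq[of "s *\<^sub>R v" "t *\<^sub>R w"] that by simp
    also have "\<dots> \<le> h * norm v + h * norm w"
      using that by (intro add_mono mult_right_mono) auto
    also have "\<dots> < h * (norm v + norm w + 1)"
      using h by (simp add: algebra_simps)
    also have "\<dots> = d" using pos by (simp add: h_def)
    finally show ?thesis .
  qed
  have in_U: "x + s *\<^sub>R v + t *\<^sub>R w \<in> U" if "0 \<le> s" "s \<le> h" "0 \<le> t" "t \<le> h" for s t
    using near[OF that] d0 by (simp add: d_def)
  have in_U': "x + s *\<^sub>R w + t *\<^sub>R v \<in> U" if "0 \<le> s" "s \<le> h" "0 \<le> t" "t \<le> h" for s t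
    using in_U[of t s] that by (simp add: ac_simps)
  obtain s1 t1 where 1: "0 \<le> s1" "s1 \<le> h" "0 \<le> t1" "t1 \<le> h"
    "u (x + h *\<^sub>R v + h *\<^sub>R w) - u (x + h *\<^sub>R v) - u (x + h *\<^sub>R w) + u x
      = h * h * uv (x + s1 *\<^sub>R v + t1 *\<^sub>R w) w"
    using second_difference_mvt[OF h in_U du ddv] by blast
  obtain s2 t2 where 2: "0 \<le> s2" "s2 \<le> h" "0 \<le> t2" "t2 \<le> h"
    "u (x + h *\<^sub>R w + h *\<^sub>R v) - u (x + h *\<^sub>R w) - u (x + h *\<^sub>R v) + u x
      = h * h * uw (x + s2 *\<^sub>R w + t2 *\<^sub>R v) v"
    using second_difference_mvt[OF h in_U' du ddw] by blast
  \<comment> \<open>The two second differences agree up to the order of their summands.\<close>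
  have "h * h * uv (x + s1 *\<^sub>R v + t1 *\<^sub>R w) w = h * h * uw (x + t2 *\<^sub>R v + s2 *\<^sub>R w) v"
    using 1(5) 2(5) by (simp only: add.commute add.left_commute add.assoc)
  then have "uv (x + s1 *\<^sub>R v + t1 *\<^sub>R w) w = uw (x + t2 *\<^sub>R v + s2 *\<^sub>R w) v"
    using h by simp
  moreover have "dist (uv (x + s1 *\<^sub>R v + t1 *\<^sub>R w) w) (uv x w) < e"
    using d1 near[OF 1(1-4)] by (simp add: d_def)
  moreover have "dist (uw (x + t2 *\<^sub>R v + s2 *\<^sub>R w) v) (uw x v) < e"
    using d2 near[OF 2(3,4,1,2)] by (simp add: d_def)
  ultimately have "\<bar>uv x w - uw x v\<bar> < 2 * e"
    by (simp add: dist_real_def)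
  then show False by (simp add: e_def)
qed

section \<open>Smooth maps and the symmetry of their second derivatives\<close>

lemma smooth_on_differentiable:
  "smooth_on S f \<Longrightarrow> x \<in> S \<Longrightarrow> f differentiable (at x)"
  unfolding smooth_on_def by (meson higher_differentiable_on.simps(2))

lemma smooth_on_frechet_derivative:
  "smooth_on S f \<Longrightarrow> smooth_on S (\<lambda>x. frechet_derivative f (at x) v)"
  unfolding smooth_on_def using higher_differentiable_on.simps(2) by blast

lemma smooth_on_continuous_on: "smooth_on S f \<Longrightarrow> continuous_on S f"
  unfolding smooth_on_def by (meson higher_differentiable_on.simps(1))

lemma smooth_on_has_derivative:
  "smooth_on S f \<Longrightarrow> x \<in> S \<Longrightarrow> (f has_derivative frechet_derivative f (at x)) (at x)"
  using smooth_on_differentiable frechet_derivative_works by blast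

text \<open>Reduces to the real-valued case coordinate by coordinate; smoothness supplies the
  continuity of the mixed derivatives.\<close>

lemma smooth_on_second_derivative_commute:
  fixes f :: "'a::real_normed_vector \<Rightarrow> 'b::euclidean_space"
  assumes U: "open U" "x \<in> U" and f: "smooth_on U f"
  shows "frechet_derivative (\<lambda>y. frechet_derivative f (at y) v) (at x) w
       = frechet_derivative (\<lambda>y. frechet_derivative f (at y) w) (at x) v"
proof (rule euclidean_eqI)
  fix b :: 'b assume "b \<in> Basis"
  define D where "D z y = frechet_derivative (\<lambda>y. frechet_derivative f (at y) z) (at y)" for z y
  have cont: "isCont (\<lambda>y. D z y z' \<bullet> b) x" for z z'
  proof -
    have "continuous_on U (\<lambda>y. D z y z')"
      unfolding D_def by (intro smooth_on_continuous_on smooth_on_frechet_derivative f)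
    then have "isCont (\<lambda>y. D z y z') x"
      using U continuous_on_eq_continuous_at by blast
    then show ?thesis by (intro continuous_intros)
  qed
  have dd: "((\<lambda>y. frechet_derivative f (at y) z \<bullet> b) has_derivative (\<lambda>z'. D z y z' \<bullet> b)) (at y)"
    if "y \<in> U" for y z
    unfolding D_def
    by (intro has_derivative_inner_left smooth_on_has_derivative[OF smooth_on_frechet_derivative[OF f] that])
  have "D v x w \<bullet> b = D w x v \<bullet> b"
    by (rule mixed_derivatives_eq_real[where u = "\<lambda>y. f y \<bullet> b"
          and u' = "\<lambda>y z. frechet_derivative f (at y) z \<bullet> b", OF U])
      (auto intro: dd cont has_derivative_inner_left smooth_on_has_derivative[OF f])
  then show "frechet_derivative (\<lambda>y. frechet_derivative f (at y) v) (at x) w \<bullet> b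
    = frechet_derivative (\<lambda>y. frechet_derivative f (at y) w) (at x) v \<bullet> b"
    by (simp add: D_def)
qed

section \<open>Linear algebra\<close>

text \<open>The intersection of the kernel of \<open>B t\<close> with a complement of a hyperplane of the kernel of
  \<open>B 0\<close> not containing \<open>y\<close> has positive dimension; unit vectors in it accumulate at a multiple
  of \<open>y\<close>.\<close>

lemma kernel_preserved_derivative_zero:
  fixes B :: "real \<Rightarrow> 'a::euclidean_space \<Rightarrow> 'a \<Rightarrow> real"
  assumes lin: "\<And>t w. linear (\<lambda>v. B t v w)"
    and sym: "\<And>v w. B 0 v w = B 0 w v"
    and der: "\<And>v w. ((\<lambda>t. B t v w) has_real_derivative D v w) (at 0)"
    and dim: "\<forall>\<^sub>F t in at 0. dim {v. \<forall>w. B 0 v w = 0} \<le> dim {v. \<forall>w. B t v w = 0}"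
    and y: "\<And>w. B 0 y w = 0" and z: "\<And>w. B 0 z w = 0"
  shows "D y z = 0"
proof (cases "y = 0")
  case True
  have "B t 0 z = 0" for t using linear_0[OF lin] by simp
  then have "((\<lambda>t. 0) has_real_derivative D y z) (at 0)"
    using der[of y z] True by simp
  then show ?thesis using DERIV_const DERIV_unique by blast
next
  case False
  have Blin: "B t 0 w = 0" "B t (u + v) w = B t u w + B t v w" "B t (r *\<^sub>R v) w = r * B t v w"
    for t u v w r
    using linear_0[OF lin] linear_add[OF lin] linear_scale[OF lin] by auto
  define K where "K t = {v. \<forall>w. B t v w = 0}" for t
  have subK: "subspace (K t)" for t
    unfolding K_def subspace_def
    by (auto simp: Blin)
  \<comment> \<open>\<open>H\<close> is the hyperplane of \<open>K 0\<close> orthogonal to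
    \<open>y\<close>, and \<open>L\<close> its orthogonal complement in the whole space. Thus
    \<open>K 0\<close> meets \<open>L\<close> exactly in the line through \<open>y\<close>.\<close>
  define H where "H = K 0 \<inter> {v. v \<bullet> y = 0}"
  define L where "L = {v. \<forall>k\<in>H. orthogonal k v}"
  have subH: "subspace H" unfolding H_def
    using subK[of 0] by (auto simp: subspace_def inner_add_left)
  have subL: "subspace L" unfolding L_def subspace_def
    by (auto simp: orthogonal_clauses)
  have dimL: "dim L + dim H = DIM('a)"
    using dim_subspace_orthogonal_to_vectors[OF subH subspace_UNIV] by (simp add: L_def)
  have yK: "y \<in> K 0" using y by (simp add: K_def)
  have "dim H < dim (K 0)"
  proof (rule dim_psubset)
    have "span H = H" "span (K 0) = K 0" using subH subK by (simp_all add: span_eq_iff)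
    moreover have "y \<notin> H" "H \<subseteq> K 0" using False by (auto simp: H_def)
    ultimately show "span H \<subset> span (K 0)" using yK by blast
  qed
  then have meet: "\<exists>v. norm v = 1 \<and> v \<in> K t \<inter> L" if "dim (K 0) \<le> dim (K t)" for t
  proof -
    \<comment> \<open>As \<open>dim H < dim (K 0)\<close>, the dimensions of \<open>K t\<close> and
      \<open>L\<close> add up to more than that of the space, which forces a nonzero
      intersection.\<close>
    have "dim {x + y |x y. x \<in> K t \<and> y \<in> L} + dim (K t \<inter> L) = dim (K t) + dim L"
      by (rule dim_sums_Int[OF subK subL])
    moreover have "dim {x + y |x y. x \<in> K t \<and> y \<in> L} \<le> DIM('a)" by (rule dim_subset_UNIV)
    ultimately have "dim (K t \<inter> L) > 0"
      using that dimL \<open>dim H < dim (K 0)\<close> by linarith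
    then have "\<not> K t \<inter> L \<subseteq> {0}" by (metis dim_eq_0 less_irrefl)
    then obtain v where "v \<in> K t \<inter> L" "v \<noteq> 0" by blast
    then have "(1 / norm v) *\<^sub>R v \<in> K t \<inter> L" "norm ((1 / norm v) *\<^sub>R v) = 1"
      using subK subL by (auto simp: subspace_scale)
    then show ?thesis by blast
  qed
  \<comment> \<open>A null sequence of nonzero parameters, unrelated to the vector field
    \<open>T\<close> of the hypersurface; it is entered at \<open>n0\<close>, from where on the
    dimension bound holds.\<close>
  define T where "T n = 1 / real (Suc n)" for n
  have T0: "T \<longlonglongrightarrow> 0" unfolding T_def by (rule LIMSEQ_Suc[OF lim_inverse_n'])
  have Tne: "T n \<noteq> 0" for n by (simp add: T_def)
  have T_at: "filterlim T (at 0) sequentially"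
    using T0 Tne by (simp add: filterlim_at)
  have "\<forall>\<^sub>F n in sequentially. dim (K 0) \<le> dim (K (T n))"
    using dim T_at unfolding K_def filterlim_iff by blast
  then obtain n0 where n0: "\<And>n. n \<ge> n0 \<Longrightarrow> dim (K 0) \<le> dim (K (T n))"
    unfolding eventually_sequentially by blast
  have "\<forall>n. \<exists>v. norm v = 1 \<and> v \<in> K (T (n0 + n)) \<inter> L"
    using meet n0 by simp
  then obtain q where q: "\<And>n. norm (q n) = 1" "\<And>n. q n \<in> K (T (n0 + n))" "\<And>n. q n \<in> L"
    by (metis IntD1 IntD2)
  obtain l r where r: "strict_mono (r :: nat \<Rightarrow> nat)" and l: "(q \<circ> r) \<longlonglongrightarrow> l"
    using compact_sphere[of "0::'a" 1, unfolded compact_def, rule_format, of q] q(1) by auto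
  define a where "a n = q (r n)" for n
  define \<tau> where "\<tau> n = T (n0 + r n)" for n
  have a: "a \<longlonglongrightarrow> l" using l by (simp add: a_def[abs_def] o_def)
  have \<tau>ne: "\<tau> n \<noteq> 0" for n by (simp add: \<tau>_def Tne)
  have "strict_mono (\<lambda>n. n0 + r n)" using r by (simp add: strict_mono_def)
  from LIMSEQ_subseq_LIMSEQ[OF T0 this] have "\<tau> \<longlonglongrightarrow> 0" by (simp add: \<tau>_def[abs_def] o_def)
  then have \<tau>_at: "filterlim \<tau> (at 0) sequentially" using \<tau>ne by (simp add: filterlim_at)
  have aK: "B (\<tau> n) (a n) w = 0" for n w using q(2)[of "r n"] by (simp add: K_def a_def \<tau>_def)
  \<comment> \<open>Differentiability is known only for fixed arguments of \<open>B\<close>.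
    Expanding in the basis turns limits with moving first argument \<open>a n\<close> into finite
    sums of such limits.\<close>
  have expand: "B t v w = (\<Sum>i\<in>Basis. (v \<bullet> i) * B t i w)" for t v w
  proof -
    have "B t (\<Sum>i\<in>Basis. (v \<bullet> i) *\<^sub>R i) w = (\<Sum>i\<in>Basis. (v \<bullet> i) * B t i w)"
      by (subst linear_sum[OF lin]) (simp add: Blin)
    then show ?thesis by (simp add: euclidean_representation)
  qed
  have "norm l = 1"
    using tendsto_norm[OF a] by (simp add: a_def q(1) LIMSEQ_const_iff)
  have "l \<in> L"
    by (rule closed_sequentially[OF closed_subspace[OF subL] _ a]) (simp add: a_def q(3))
  have "B 0 l w = 0" for w
  proof -
    have "(\<lambda>n. B (\<tau> n) i w) \<longlonglongrightarrow> B 0 i w" for i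
      by (rule filterlim_compose[OF DERIV_isCont[OF der, unfolded isCont_def] \<tau>_at])
    then have "(\<lambda>n. \<Sum>i\<in>Basis. (a n \<bullet> i) * B (\<tau> n) i w) \<longlonglongrightarrow> (\<Sum>i\<in>Basis. (l \<bullet> i) * B 0 i w)"
      using a by (intro tendsto_intros)
    then have "(\<lambda>n. B (\<tau> n) (a n) w) \<longlonglongrightarrow> B 0 l w"
      by (simp only: expand[symmetric])
    then show ?thesis using aK by (simp add: LIMSEQ_const_iff)
  qed
  then have lK: "l \<in> K 0" by (simp add: K_def)
  \<comment> \<open>The component of \<open>l\<close> orthogonal to \<open>y\<close> lies in
    \<open>H\<close>, hence is orthogonal to \<open>l\<close>, hence to itself.\<close>
  have ly: "l = ((l \<bullet> y) / (y \<bullet> y)) *\<^sub>R y"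
  proof -
    define k where "k = l - ((l \<bullet> y) / (y \<bullet> y)) *\<^sub>R y"
    have "k \<in> K 0" using lK yK subK by (simp add: k_def subspace_diff subspace_scale)
    moreover have ky: "k \<bullet> y = 0" using False by (simp add: k_def inner_diff_left)
    ultimately have "k \<bullet> l = 0" using \<open>l \<in> L\<close> by (auto simp: H_def L_def orthogonal_def)
    then have "k \<bullet> k = 0" using ky by (subst (2) k_def) (simp add: inner_diff_right)
    then show ?thesis by (simp add: k_def)
  qed
  define c where "c = (l \<bullet> y) / (y \<bullet> y)"
  have c: "l = c *\<^sub>R y" "c \<noteq> 0" using ly \<open>norm l = 1\<close> by (auto simp: c_def)
  have "(\<lambda>n. (B (\<tau> n) i z - B 0 i z) / \<tau> n) \<longlonglongrightarrow> D i z" for i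
    using filterlim_compose[OF der[of i z, unfolded has_field_derivative_iff] \<tau>_at] by simp
  then have "(\<lambda>n. \<Sum>i\<in>Basis. (a n \<bullet> i) * ((B (\<tau> n) i z - B 0 i z) / \<tau> n)) \<longlonglongrightarrow> (\<Sum>i\<in>Basis. (l \<bullet> i) * D i z)"
    using a by (intro tendsto_intros)
  \<comment> \<open>This is the difference quotient with \<open>a n\<close> in the first slot:
    \<open>a n\<close> is in the kernel at \<open>\<tau> n\<close>, and \<open>z\<close> in the
    kernel at 0, where the form is symmetric.\<close>
  moreover have "(\<Sum>i\<in>Basis. (a n \<bullet> i) * ((B (\<tau> n) i z - B 0 i z) / \<tau> n)) = 0" for n
  proof -
    have "(\<Sum>i\<in>Basis. (a n \<bullet> i) * ((B (\<tau> n) i z - B 0 i z) / \<tau> n)) = (B (\<tau> n) (a n) z - B 0 (a n) z) / \<tau> n"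
      by (subst (1 2) expand[of _ "a n" z])
        (simp add: sum_divide_distrib sum_subtractf right_diff_distrib diff_divide_distrib)
    also have "\<dots> = 0" using aK z[of "a n"] sym[of "a n" z] by simp
    finally show ?thesis .
  qed
  ultimately have sum0: "(\<Sum>i\<in>Basis. (l \<bullet> i) * D i z) = 0" by (simp add: LIMSEQ_const_iff)
  \<comment> \<open>Linearity of \<open>D\<close> in its first argument, obtained from uniqueness of
    derivatives; it transfers the vanishing from \<open>l\<close> to its multiple
    \<open>y\<close>.\<close>
  have "((\<lambda>t. \<Sum>i\<in>Basis. (y \<bullet> i) * B t i z) has_real_derivative (\<Sum>i\<in>Basis. (y \<bullet> i) * D i z)) (at 0)"
    by (intro DERIV_sum DERIV_cmult der)
  then have "D y z = (\<Sum>i\<in>Basis. (y \<bullet> i) * D i z)"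
    unfolding expand[of _ y z, symmetric] using der[of y z] DERIV_unique by blast
  moreover have "(\<Sum>i\<in>Basis. (l \<bullet> i) * D i z) = c * (\<Sum>i\<in>Basis. (y \<bullet> i) * D i z)"
    by (simp add: c sum_distrib_left mult.assoc)
  ultimately show ?thesis using sum0 c by simp
qed

text \<open>A maximiser \<open>v\<close> of the Rayleigh quotient \<open>G (A v) v / G v v\<close> on the unit sphere of \<open>W\<close>
  is an eigenvector.\<close>

lemma self_adjoint_invariant_subspace_eigenvector:
  fixes G :: "'a::euclidean_space \<Rightarrow> 'a \<Rightarrow> real"
  assumes G: "bilinear G" and sym: "\<And>v w. G v w = G w v" and pos: "\<And>v. v \<noteq> 0 \<Longrightarrow> 0 < G v v"
    and A: "linear A" and adj: "\<And>v w. G (A v) w = G v (A w)"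
    and W: "subspace W" "\<And>v. v \<in> W \<Longrightarrow> A v \<in> W" "u \<in> W" "u \<noteq> 0"
  obtains l v where "v \<in> W" "v \<noteq> 0" "A v = l *\<^sub>R v"
proof -
  have bb: "bounded_bilinear G" using G bilinear_conv_bounded_bilinear by blast
  define S where "S = W \<inter> sphere 0 1"
  have "compact S" unfolding S_def
    by (intro closed_Int_compact closed_subspace W(1) compact_sphere)
  have "(1 / norm u) *\<^sub>R u \<in> S" using W by (simp add: S_def subspace_scale)
  then have "S \<noteq> {}" by blast
  have ne: "G v v \<noteq> 0" if "v \<in> S" for v
  proof -
    have "v \<noteq> 0" using that by (auto simp: S_def)
    then show ?thesis using pos[of v] by simp
  qed
  have "continuous_on S (\<lambda>v. G (A v) v / G v v)"
    using ne linear_continuous_on[of A] A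
    by (intro continuous_on_divide bounded_bilinear.continuous_on[OF bb] continuous_on_id)
       (auto simp: linear_conv_bounded_linear)
  then obtain v where v: "v \<in> S" and max: "\<And>w. w \<in> S \<Longrightarrow> G (A w) w / G w w \<le> G (A v) v / G v v"
    using continuous_attains_sup[OF \<open>compact S\<close> \<open>S \<noteq> {}\<close>] by blast
  have vW: "v \<in> W" and vn: "v \<noteq> 0" using v by (auto simp: S_def)
  define l where "l = G (A v) v / G v v"
  \<comment> \<open>By maximality of the quotient at \<open>v\<close>, this symmetric form is
    nonnegative on \<open>W\<close> and vanishes at \<open>v\<close>.\<close>
  define q where "q x y = l * G x y - G (A x) y" for x y
  note lin = bilinear_ladd[OF G] bilinear_radd[OF G] bilinear_lmul[OF G] bilinear_rmul[OF G]
    bilinear_lsub[OF G] bilinear_rsub[OF G] linear_add[OF A] linear_scale[OF A]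
  have qsym: "q x y = q y x" for x y
    using sym[of x y] sym[of "A y" x] adj[of x y] by (simp add: q_def)
  have qnn: "q w w \<ge> 0" if "w \<in> W" for w
  proof (cases "w = 0")
    case True
    then show ?thesis by (simp add: q_def linear_0[OF A] bilinear_lzero[OF G])
  next
    case False
    define s where "s = 1 / norm w"
    have "s *\<^sub>R w \<in> S" using False that W by (simp add: S_def subspace_scale s_def)
    then have "G (A (s *\<^sub>R w)) (s *\<^sub>R w) / G (s *\<^sub>R w) (s *\<^sub>R w) \<le> l" using max by (simp add: l_def)
    moreover have "s \<noteq> 0" using False by (simp add: s_def)
    ultimately have "G (A w) w / G w w \<le> l" by (simp add: lin)
    then show ?thesis using pos[OF False] by (simp add: q_def field_simps)
  qed
  have qv: "q v v = 0" using pos[OF vn] by (simp add: q_def l_def)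
  \<comment> \<open>The residual of the eigenvalue equation; \<open>q v w = G w w\<close> measures
    its size.\<close>
  define w where "w = l *\<^sub>R v - A v"
  have wW: "w \<in> W" using vW W by (simp add: w_def subspace_diff subspace_scale)
  have qvw: "q v w = G w w" by (simp add: q_def w_def lin algebra_simps)
  have "G w w = 0"
  proof (rule ccontr)
    assume nz: "G w w \<noteq> 0"
    then have gp: "G w w > 0" using pos[of w] bilinear_lzero[OF G, of 0] by (cases "w = 0") auto
    \<comment> \<open>If \<open>G w w > 0\<close>, a small step from \<open>v\<close> against
      \<open>w\<close> makes \<open>q\<close> negative. The summand 1 keeps the denominator positive
      when \<open>q w w = 0\<close>.\<close>
    define t where "t = - G w w / (q w w + 1)"
    have "q w w + 1 > 0" using qnn[OF wW] by simp
    have "q (v + t *\<^sub>R w) (v + t *\<^sub>R w) \<ge> 0"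
      using qnn vW wW W by (simp add: subspace_add subspace_scale)
    moreover have "q (v + t *\<^sub>R w) (v + t *\<^sub>R w) = q v v + t * q v w + t * q w v + t * t * q w w"
      by (simp add: q_def lin algebra_simps)
    ultimately have "2 * t * G w w + t * t * q w w \<ge> 0"
      using qv qvw qsym[of w v] by simp
    moreover have "t < 0" using gp \<open>q w w + 1 > 0\<close> by (simp add: t_def)
    ultimately have "2 * G w w + t * q w w \<le> 0"
      using mult_neg_pos[of t "2 * G w w + t * q w w"] by (auto simp: algebra_simps not_le[symmetric])
    moreover have "t * (q w w + 1) = - G w w" using \<open>q w w + 1 > 0\<close> by (simp add: t_def)
    ultimately show False using gp \<open>t < 0\<close> by (simp add: algebra_simps)
  qed
  then have "w = 0" using pos[of w] by (cases "w = 0") auto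
  then show ?thesis using that[of v l] vW vn by (simp add: w_def)
qed

section \<open>Parametrized hypersurfaces\<close>

lemma bilinear_qform_fst: "bilinear (\<lambda>v w :: 'n::finite ambient. qform c (fst v) (fst w))"
  by (auto simp: bilinear_def qform_def inner_simps algebra_simps intro!: linearI)

lemma bilinear_ambient_metric: "bilinear (ambient_metric c :: 'n::finite ambient \<Rightarrow> _)"
  by (auto simp: bilinear_def ambient_metric_def qform_def inner_simps algebra_simps intro!: linearI)

lemma ambient_metric_commute: "ambient_metric c v w = ambient_metric c w v"
  by (simp add: ambient_metric_def qform_def inner_commute)

lemma qform_commute: "qform c v w = qform c w v"
  by (simp add: qform_def inner_commute)

lemma linear_tangent_proj: "linear (tangent_proj c y)"
  by (rule linearI) (auto simp: tangent_proj_def qform_def inner_simps algebra_simps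
      scaleR_add_left[symmetric] simp del: scaleR_add_left)

text \<open>The projection removes a multiple of the position vector, which is orthogonal to the
  tangent vector \<open>w\<close>.\<close>

lemma ambient_metric_tangent_proj:
  assumes "qform c (fst y) (fst w) = 0"
  shows "ambient_metric c (tangent_proj c y v) w = ambient_metric c v w"
proof -
  have "c * fst (fst y) * fst (fst w) + snd (fst y) \<bullet> snd (fst w) = 0"
    using assms by (simp add: qform_def)
  then have "snd (fst y) \<bullet> snd (fst w) = - (c * fst (fst y) * fst (fst w))" by linarith
  then show ?thesis
    by (simp add: tangent_proj_def ambient_metric_def qform_def inner_simps algebra_simps)
qed

text \<open>The product rule compared with the zero derivative of a constant. All orthogonality and
  length relations below are differentiated in this form.\<close>

lemma constant_pairing_derivative:
  assumes P: "bilinear (P :: 'b::euclidean_space \<Rightarrow> 'b \<Rightarrow> real)" and U: "open U" "x \<in> U"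
    and u: "(u has_derivative u') (at x)" and v: "(v has_derivative v') (at x)"
    and k: "\<And>y. y \<in> U \<Longrightarrow> P (u y) (v y) = k"
  shows "P (u x) (v' w) + P (u' w) (v x) = 0"
proof -
  have bb: "bounded_bilinear P" using P bilinear_conv_bounded_bilinear by blast
  have "((\<lambda>y. P (u y) (v y)) has_derivative (\<lambda>w. P (u x) (v' w) + P (u' w) (v x))) (at x)"
    by (rule bounded_bilinear.FDERIV[OF bb u v])
  moreover have "((\<lambda>y. P (u y) (v y)) has_derivative (\<lambda>w. 0)) (at x)"
    by (rule has_derivative_transform_within_open[OF has_derivative_const U]) (simp add: k)
  ultimately show ?thesis by (metis has_derivative_unique)
qed

lemma has_vector_derivative_along_line:
  assumes "(h has_derivative h') (at x)"
  shows "((\<lambda>t. h (x + t *\<^sub>R v)) has_vector_derivative h' v) (at 0)"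
proof -
  have "((\<lambda>t::real. h (x + t *\<^sub>R v)) has_derivative (\<lambda>t. h' (t *\<^sub>R v))) (at 0)"
    by (rule has_derivative_compose[where g=h]) (auto intro!: derivative_eq_intros assms)
  moreover have "(\<lambda>t. h' (t *\<^sub>R v)) = (\<lambda>t. t *\<^sub>R h' v)"
    using has_derivative_linear[OF assms] by (simp add: linear_scale)
  ultimately show ?thesis by (simp add: has_vector_derivative_def)
qed

text \<open>The picture in a single chart, where \<open>F\<close> is the immersion and
  \<open>N\<close> the normal field, so that ordinary Frechet derivatives suffice. The equation
  \<open>c * c = 1\<close> treats both signs of the curvature at once.\<close>

locale parametrized_hypersurface =
  fixes c :: real and U :: "(real ^ 'n::finite) set" and F N :: "real ^ 'n \<Rightarrow> 'n ambient"
  assumes c: "c * c = 1"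
    and U: "open U"
    and F: "smooth_on U F" and N: "smooth_on U N"
    and position: "\<And>x. x \<in> U \<Longrightarrow> qform c (fst (F x)) (fst (F x)) = c"
    and tangent: "\<And>x. x \<in> U \<Longrightarrow> qform c (fst (F x)) (fst (N x)) = 0"
    and normal: "\<And>x v. x \<in> U \<Longrightarrow> ambient_metric c (N x) (frechet_derivative F (at x) v) = 0"
begin

abbreviation DF where "DF x \<equiv> frechet_derivative F (at x)"
abbreviation DN where "DN x \<equiv> frechet_derivative N (at x)"
abbreviation D2F where "D2F x v w \<equiv> frechet_derivative (\<lambda>y. DF y v) (at x) w"
abbreviation D2N where "D2N x v w \<equiv> frechet_derivative (\<lambda>y. DN y v) (at x) w"

lemmas has_DF = smooth_on_has_derivative[OF F]
lemmas has_DN = smooth_on_has_derivative[OF N]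
lemmas has_D2F = smooth_on_has_derivative[OF smooth_on_frechet_derivative[OF F]]
lemmas has_D2N = smooth_on_has_derivative[OF smooth_on_frechet_derivative[OF N]]
lemmas linear_DF = has_derivative_linear[OF has_DF]
lemmas linear_DN = has_derivative_linear[OF has_DN]
lemmas D2F_commute = smooth_on_second_derivative_commute[OF U _ F]
lemmas D2N_commute = smooth_on_second_derivative_commute[OF U _ N]

lemma qform_F_DF: "x \<in> U \<Longrightarrow> qform c (fst (F x)) (fst (DF x v)) = 0"
  using constant_pairing_derivative[OF bilinear_qform_fst[of c] U _ has_DF has_DF, of x c v] position
  by (simp add: qform_commute)

text \<open>A further derivative of \<open>qform_F_DF\<close>. This is the Gauss formula of the
  space form, and through it the curvature enters the Codazzi equation.\<close>

lemma qform_F_D2F: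
  assumes "x \<in> U"
  shows "qform c (fst (F x)) (fst (D2F x v w)) = - qform c (fst (DF x v)) (fst (DF x w))"
proof -
  have "qform c (fst (F x)) (fst (D2F x v w)) + qform c (fst (DF x w)) (fst (DF x v)) = 0"
    by (rule constant_pairing_derivative[OF bilinear_qform_fst[of c] U assms has_DF has_D2F])
      (simp_all add: assms qform_F_DF)
  then show ?thesis using qform_commute by (metis eq_neg_iff_add_eq_0)
qed

text \<open>Differentiating \<open>tangent\<close> leaves the pairing of the first components of
  \<open>DF\<close> and \<open>N\<close>, which \<open>normal\<close> turns into the product of
  their vertical components.\<close>

lemma qform_F_DN:
  assumes "x \<in> U"
  shows "qform c (fst (F x)) (fst (DN x v)) = snd (DF x v) * snd (N x)"
proof -
  have "qform c (fst (F x)) (fst (DN x v)) + qform c (fst (DF x v)) (fst (N x)) = 0"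
    by (rule constant_pairing_derivative[OF bilinear_qform_fst[of c] U assms has_DF has_DN])
      (simp_all add: assms tangent)
  moreover have "qform c (fst (DF x v)) (fst (N x)) + snd (DF x v) * snd (N x) = 0"
    using normal[OF assms, of v] by (simp add: ambient_metric_def qform_commute mult.commute)
  ultimately show ?thesis by linarith
qed

text \<open>Differentiating \<open>normal\<close> moves the derivative from \<open>N\<close> to
  \<open>DF\<close>. The right-hand side is symmetric because second derivatives commute, and this
  later makes \<open>A\<close> self-adjoint.\<close>

lemma second_fundamental_form:
  assumes "x \<in> U"
  shows "ambient_metric c (DN x v) (DF x w) = - ambient_metric c (N x) (D2F x v w)"
proof -
  have "ambient_metric c (N x) (D2F x w v) + ambient_metric c (DN x v) (DF x w) = 0"
    by (rule constant_pairing_derivative[OF bilinear_ambient_metric U assms has_DN has_D2F])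
      (simp_all add: assms normal)
  then show ?thesis using D2F_commute[OF assms, of w v] by simp
qed

lemma second_fundamental_form_commute:
  assumes "x \<in> U"
  shows "ambient_metric c (DN x v) (DF x w) = ambient_metric c (DN x w) (DF x v)"
  using second_fundamental_form[OF assms] D2F_commute[OF assms] by metis

text \<open>This is the form \<open>\<langle>(l - A) v, w\<rangle>\<close> with \<open>A\<close>
  expressed by the Weingarten formula. The projection in that formula disappears because
  \<open>DF x w\<close> is tangent, which leaves an expression easy to differentiate in
  \<open>x\<close>.\<close>

definition shape_form :: "real \<Rightarrow> real ^ 'n \<Rightarrow> real ^ 'n \<Rightarrow> real ^ 'n \<Rightarrow> real" where
  "shape_form l x v w = ambient_metric c (DN x v + l *\<^sub>R DF x v) (DF x w)"

lemma linear_shape_form: "x \<in> U \<Longrightarrow> linear (\<lambda>v. shape_form l x v w)"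
  unfolding shape_form_def
  by (rule linearI)
    (simp_all add: linear_add[OF linear_DF] linear_add[OF linear_DN] linear_scale[OF linear_DF]
      linear_scale[OF linear_DN] bilinear_ladd[OF bilinear_ambient_metric]
      bilinear_lmul[OF bilinear_ambient_metric] algebra_simps)

lemma shape_form_commute: "x \<in> U \<Longrightarrow> shape_form l x v w = shape_form l x w v"
  unfolding shape_form_def
  using second_fundamental_form_commute[of x v w] ambient_metric_commute[of c "DF x v" "DF x w"]
  by (simp add: bilinear_ladd[OF bilinear_ambient_metric] bilinear_lmul[OF bilinear_ambient_metric])

text \<open>Since the kernel does not shrink on \<open>U\<close>,
  \<open>kernel_preserved_derivative_zero\<close> applies to the forms along the line
  \<open>x + t *\<^sub>R u\<close>; the conclusion is the product rule written out.\<close>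

lemma shape_form_derivative_zero:
  assumes x: "x \<in> U"
    and dim: "\<And>y. y \<in> U \<Longrightarrow> dim {v. \<forall>w. shape_form l x v w = 0} \<le> dim {v. \<forall>w. shape_form l y v w = 0}"
    and v: "\<And>w. shape_form l x v w = 0" and z: "\<And>w. shape_form l x z w = 0"
  shows "ambient_metric c (D2N x v u + l *\<^sub>R D2F x v u) (DF x z)
       + ambient_metric c (DN x v + l *\<^sub>R DF x v) (D2F x z u) = 0"
proof -
  \<comment> \<open>The line is frozen at \<open>x\<close> outside \<open>U\<close>, so that
    linearity and the dimension bound hold for every \<open>t\<close>; the derivative at 0 sees only
    small \<open>t\<close>.\<close>
  define y where "y t = (if x + t *\<^sub>R u \<in> U then x + t *\<^sub>R u else x)" for t
  have yU: "y t \<in> U" and y0: "y 0 = x" for t using x by (simp_all add: y_def)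
  define B where "B t v w = shape_form l (y t) v w" for t v w
  define D where "D v w = ambient_metric c (DN x v + l *\<^sub>R DF x v) (D2F x w u)
      + ambient_metric c (D2N x v u + l *\<^sub>R D2F x v u) (DF x w)" for v w
  have near: "\<forall>\<^sub>F t in nhds 0. x + t *\<^sub>R u \<in> U"
  proof -
    have "((\<lambda>t. x + t *\<^sub>R u) \<longlongrightarrow> x + 0 *\<^sub>R u) (nhds 0)"
      by (intro tendsto_intros filterlim_ident)
    then show ?thesis using U x by (auto dest: topological_tendstoD)
  qed
  have der: "((\<lambda>t. B t v w) has_real_derivative D v w) (at 0)" for v w
  proof -
    have bb: "bounded_bilinear (ambient_metric c :: 'n ambient \<Rightarrow> _)"
      using bilinear_ambient_metric bilinear_conv_bounded_bilinear by blast
    have "((\<lambda>t. shape_form l (x + t *\<^sub>R u) v w) has_vector_derivative D v w) (at 0)"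
    proof -
      have "((\<lambda>t. DN (x + t *\<^sub>R u) v + l *\<^sub>R DF (x + t *\<^sub>R u) v)
          has_vector_derivative D2N x v u + l *\<^sub>R D2F x v u) (at 0)"
        by (intro has_vector_derivative_along_line[where h = "\<lambda>y. DN y v + l *\<^sub>R DF y v"
              and h' = "\<lambda>u. D2N x v u + l *\<^sub>R D2F x v u"]
            has_derivative_add has_derivative_scaleR_right has_D2F has_D2N x)
      moreover have "((\<lambda>t. DF (x + t *\<^sub>R u) w) has_vector_derivative D2F x w u) (at 0)"
        by (intro has_vector_derivative_along_line[where h = "\<lambda>y. DF y w"] has_D2F x)
      ultimately show ?thesis
        using bounded_bilinear.has_vector_derivative[OF bb] unfolding shape_form_def D_def by fastforce
    qed
    then have "((\<lambda>t. shape_form l (x + t *\<^sub>R u) v w) has_real_derivative D v w) (at 0)"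
      by (simp add: has_real_derivative_iff_has_vector_derivative)
    moreover have "\<forall>\<^sub>F t in nhds 0. B t v w = shape_form l (x + t *\<^sub>R u) v w"
      using near by eventually_elim (simp add: B_def y_def)
    ultimately show ?thesis by (subst DERIV_cong_ev[OF refl _ refl]) auto
  qed
  have "D v z = 0"
  proof (rule kernel_preserved_derivative_zero[where B = B])
    show "linear (\<lambda>v. B t v w)" for t w unfolding B_def by (rule linear_shape_form[OF yU])
    show "B 0 v w = B 0 w v" for v w unfolding B_def by (rule shape_form_commute[OF yU])
    show "((\<lambda>t. B t v w) has_real_derivative D v w) (at 0)" for v w by (rule der)
    show "\<forall>\<^sub>F t in at 0. dim {v. \<forall>w. B 0 v w = 0} \<le> dim {v. \<forall>w. B t v w = 0}"
      using dim[OF yU] by (simp add: B_def y0)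
  qed (simp_all add: B_def y0 v z)
  then show ?thesis by (simp add: D_def)
qed

text \<open>Antisymmetrising \<open>shape_form_derivative_zero\<close> in two eigenvectors is the Codazzi equation
  restricted to the eigenspace \<open>E\<close>: with \<open>\<tau> = snd \<circ> DF x\<close> it reads \<open>\<tau> v * G u z = \<tau> u * G v z\<close>,
  so \<open>\<tau> v *\<^sub>R u = \<tau> u *\<^sub>R v\<close>.\<close>

lemma vertical_part_zero_on_eigenspace:
  assumes x: "x \<in> U"
    and pos: "\<And>v. v \<noteq> 0 \<Longrightarrow> 0 < ambient_metric c (DF x v) (DF x v)"
    and dim: "\<And>y. y \<in> U \<Longrightarrow> dim {v. \<forall>w. shape_form l x v w = 0} \<le> dim {v. \<forall>w. shape_form l y v w = 0}"
    and E: "subspace E" "2 \<le> dim E"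
    and eigen: "\<And>v. v \<in> E \<Longrightarrow> tangent_proj c (F x) (DN x v) = - (l *\<^sub>R DF x v)"
    and nz: "snd (N x) \<noteq> 0"
    and v: "v \<in> E"
  shows "snd (DF x v) = 0"
proof (rule ccontr)
  define \<tau> where "\<tau> v = snd (DF x v)" for v
  define G where "G v w = ambient_metric c (DF x v) (DF x w)" for v w
  assume "snd (DF x v) \<noteq> 0"
  then have \<tau>v: "\<tau> v \<noteq> 0" by (simp add: \<tau>_def)
  \<comment> \<open>On \<open>E\<close> the tangential part of this vector vanishes by
    \<open>eigen\<close>, so only a multiple of the position vector remains.\<close>
  have normal_part: "DN x v + l *\<^sub>R DF x v = (c * \<tau> v * snd (N x)) *\<^sub>R (fst (F x), 0)" if "v \<in> E" for v
    using eigen[OF that] qform_F_DN[OF x, of v] by (simp add: tangent_proj_def \<tau>_def algebra_simps)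
  have pairing: "ambient_metric c (DN x v + l *\<^sub>R DF x v) w = c * \<tau> v * snd (N x) * qform c (fst (F x)) (fst w)"
    if "v \<in> E" for v w
    unfolding normal_part[OF that] by (simp add: ambient_metric_def qform_def algebra_simps)
  have kernel: "shape_form l x v w = 0" if "v \<in> E" for v w
    unfolding shape_form_def pairing[OF that] by (simp add: qform_F_DF[OF x])
  have codazzi: "\<tau> v * G u z = \<tau> u * G v z" if "u \<in> E" "v \<in> E" "z \<in> E" for u v z
  proof -
    \<comment> \<open>The second summand of \<open>shape_form_derivative_zero\<close> is evaluated
      by \<open>pairing\<close> and the Gauss formula.\<close>
    have zero: "ambient_metric c (D2N x v u + l *\<^sub>R D2F x v u) (DF x z)
       - c * \<tau> v * snd (N x) * qform c (fst (DF x z)) (fst (DF x u)) = 0" if "v \<in> E" for u v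
      using shape_form_derivative_zero[OF x dim kernel[OF that] kernel[OF \<open>z \<in> E\<close>], of u]
      by (simp add: pairing[OF that] qform_F_D2F[OF x])
    \<comment> \<open>Subtracting the relations for \<open>(u, v)\<close> and \<open>(v, u)\<close>
      cancels the second derivatives, which are symmetric.\<close>
    have "c * \<tau> v * snd (N x) * qform c (fst (DF x z)) (fst (DF x u))
        = c * \<tau> u * snd (N x) * qform c (fst (DF x z)) (fst (DF x v))"
      using zero[OF that(2), of u] zero[OF that(1), of v] D2N_commute[OF x, of u v] D2F_commute[OF x, of u v]
      by simp
    then have "\<tau> v * qform c (fst (DF x z)) (fst (DF x u)) = \<tau> u * qform c (fst (DF x z)) (fst (DF x v))"
      using nz c by auto
    \<comment> \<open>Passing from \<open>qform\<close> to the full metric produces the same term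
      \<open>\<tau> u * \<tau> v * \<tau> z\<close> on both sides.\<close>
    moreover have "qform c (fst (DF x z)) (fst (DF x w)) = G w z - \<tau> w * \<tau> z" for w
      by (simp add: G_def \<tau>_def ambient_metric_def qform_commute)
    ultimately show ?thesis by (simp add: algebra_simps)
  qed
  have "E \<subseteq> span {v}"
  proof
    fix u assume u: "u \<in> E"
    \<comment> \<open>\<open>codazzi\<close> says that \<open>w\<close> is orthogonal to
      \<open>E\<close>; as \<open>w\<close> also lies in \<open>E\<close>, it is zero.\<close>
    define w where "w = \<tau> v *\<^sub>R u - \<tau> u *\<^sub>R v"
    have "w \<in> E" using u v E by (simp add: w_def subspace_diff subspace_scale)
    have "G w z = \<tau> v * G u z - \<tau> u * G v z" for z
      by (simp add: w_def G_def linear_diff[OF linear_DF[OF x]] linear_scale[OF linear_DF[OF x]]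
        bilinear_lsub[OF bilinear_ambient_metric] bilinear_lmul[OF bilinear_ambient_metric])
    then have "G w w = 0" using codazzi[OF u v \<open>w \<in> E\<close>] by simp
    then have "w = 0" using pos[of w] by (cases "w = 0") (auto simp: G_def)
    then have "u = (\<tau> u / \<tau> v) *\<^sub>R v"
      using \<tau>v by (simp add: w_def eq_vector_fraction_iff)
    then show "u \<in> span {v}" by (metis span_base span_scale singletonI)
  qed
  then have "dim E \<le> card {v}" by (rule dim_le_card) auto
  then show False using E(2) by simp
qed

end

section \<open>Hypersurfaces in charts\<close>

lemma chart_dom_subset: "is_chart X a \<Longrightarrow> chart_dom a \<subseteq> topspace X"
  by (auto simp: is_chart_def dest: openin_subset)

lemma chart_inj_on:
  assumes "is_chart X a"
  shows "inj_on (chart_map a) (chart_dom a)"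
proof -
  have "topspace (subtopology X (chart_dom a)) = chart_dom a"
    using chart_dom_subset[OF assms] by auto
  then show ?thesis
    using assms homeomorphic_imp_injective_map unfolding is_chart_def by metis
qed

lemma chart_inv_chart_map: "is_chart X a \<Longrightarrow> q \<in> chart_dom a \<Longrightarrow> chart_inv a (chart_map a q) = q"
  by (simp add: chart_inv_def chart_inj_on)

lemma chart_inv_in_dom: "y \<in> chart_map a ` chart_dom a \<Longrightarrow> chart_inv a y \<in> chart_dom a"
  by (simp add: chart_inv_def inv_into_into)

lemma chart_map_chart_inv: "y \<in> chart_map a ` chart_dom a \<Longrightarrow> chart_map a (chart_inv a y) = y"
  by (simp add: chart_inv_def f_inv_into_f)

lemma open_chart_image:
  assumes a: "is_chart X a" and W: "openin X W" "W \<subseteq> chart_dom a"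
  shows "open (chart_map a ` W)"
proof -
  have "openin (subtopology X (chart_dom a)) W"
    using W by (auto simp: openin_subtopology)
  moreover have "open_map (subtopology X (chart_dom a)) (top_of_set (chart_map a ` chart_dom a)) (chart_map a)"
    using a homeomorphic_imp_open_map unfolding is_chart_def by blast
  ultimately have "openin (top_of_set (chart_map a ` chart_dom a)) (chart_map a ` W)"
    unfolding open_map_def by blast
  then show ?thesis using a unfolding is_chart_def by (meson openin_open_trans)
qed

lemma chart_at_works:
  assumes "smooth_atlas X \<A>" "p \<in> topspace X"
  shows "chart_at \<A> p \<in> \<A>" "p \<in> chart_dom (chart_at \<A> p)"
proof -
  have "\<exists>a. a \<in> \<A> \<and> p \<in> chart_dom a"
    using assms unfolding smooth_atlas_def by blast
  then have "chart_at \<A> p \<in> \<A> \<and> p \<in> chart_dom (chart_at \<A> p)"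
    unfolding chart_at_def by (rule someI_ex)
  then show "chart_at \<A> p \<in> \<A>" "p \<in> chart_dom (chart_at \<A> p)" by auto
qed

text \<open>\<open>coord_vector\<close> in the opposite direction: the components in \<open>a\<close> of a vector that is given
  in the preferred chart.\<close>

definition to_chart :: "('m, 'n::finite) chart set \<Rightarrow> ('m, 'n) chart \<Rightarrow> 'm \<Rightarrow> real ^ 'n \<Rightarrow> real ^ 'n" where
  "to_chart \<A> a q =
     frechet_derivative (chart_map a \<circ> chart_inv (chart_at \<A> q)) (at (chart_map (chart_at \<A> q) q))"

text \<open>The chain rule for the transition map \<open>\<theta>\<close> from the preferred chart
  \<open>b\<close> to \<open>a\<close>, which is smooth on the open set \<open>V\<close> around the
  image of \<open>q\<close>.\<close>

lemma
  assumes \<A>: "smooth_atlas X \<A>" and a: "a \<in> \<A>" "q \<in> chart_dom a"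
  shows linear_to_chart: "linear (to_chart \<A> a q)"
    and differential_to_chart: "smooth_map \<A> h \<Longrightarrow> differential \<A> h q v
      = frechet_derivative (h \<circ> chart_inv a) (at (chart_map a q)) (to_chart \<A> a q v)"
proof -
  define b where "b = chart_at \<A> q"
  have ca: "is_chart X a" using \<A> a by (simp add: smooth_atlas_def)
  then have q: "q \<in> topspace X" using a chart_dom_subset by blast
  have b: "b \<in> \<A>" "q \<in> chart_dom b" unfolding b_def by (rule chart_at_works[OF \<A> q])+
  then have cb: "is_chart X b" using \<A> by (simp add: smooth_atlas_def)
  define V where "V = chart_map b ` (chart_dom b \<inter> chart_dom a)"
  define \<theta> where "\<theta> = chart_map a \<circ> chart_inv b"
  have V: "open V" unfolding V_def
    by (rule open_chart_image[OF cb]) (use ca cb in \<open>auto simp: is_chart_def\<close>)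
  have qV: "chart_map b q \<in> V" using a b by (simp add: V_def)
  have \<theta>: "\<theta> differentiable at (chart_map b q)"
    using \<A> a b qV unfolding smooth_atlas_def V_def \<theta>_def by (blast intro: smooth_on_differentiable)
  show "linear (to_chart \<A> a q)"
    unfolding to_chart_def b_def[symmetric] \<theta>_def[symmetric]
    using \<theta> frechet_derivative_works has_derivative_linear by blast
  assume h: "smooth_map \<A> h"
  have \<theta>q: "\<theta> (chart_map b q) = chart_map a q" by (simp add: \<theta>_def chart_inv_chart_map[OF cb b(2)])
  have ha: "(h \<circ> chart_inv a) differentiable at (\<theta> (chart_map b q))"
    using h a unfolding smooth_map_def \<theta>q by (blast intro: smooth_on_differentiable)
  have hb: "(h \<circ> chart_inv b) differentiable at (chart_map b q)"
    using h b unfolding smooth_map_def by (blast intro: smooth_on_differentiable)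
  have eq: "(h \<circ> chart_inv b) y = ((h \<circ> chart_inv a) \<circ> \<theta>) y" if "y \<in> V" for y
    using that by (auto simp: V_def \<theta>_def chart_inv_chart_map[OF ca] chart_inv_chart_map[OF cb])
  have "differential \<A> h q = frechet_derivative (h \<circ> chart_inv b) (at (chart_map b q))"
    by (simp add: differential_def b_def)
  also have "\<dots> = frechet_derivative ((h \<circ> chart_inv a) \<circ> \<theta>) (at (chart_map b q))"
    by (rule frechet_derivative_transform_within_open[OF hb V qV eq])
  also have "\<dots> = frechet_derivative (h \<circ> chart_inv a) (at (chart_map a q)) \<circ> frechet_derivative \<theta> (at (chart_map b q))"
    using frechet_derivative_compose[OF \<theta> ha] by (simp only: \<theta>q)
  finally show "differential \<A> h q v
      = frechet_derivative (h \<circ> chart_inv a) (at (chart_map a q)) (to_chart \<A> a q v)"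
    by (simp add: to_chart_def b_def \<theta>_def)
qed

section \<open>The global hypotheses and their restriction to charts\<close>

locale constant_principal_curvature_hypersurface =
  fixes c :: real and X :: "'m topology" and \<A> :: "('m, 'n::finite) chart set"
    and g :: "'m \<Rightarrow> real ^ 'n \<Rightarrow> real ^ 'n \<Rightarrow> real"
    and f \<eta> :: "'m \<Rightarrow> 'n ambient" and A :: "'m \<Rightarrow> real ^ 'n \<Rightarrow> real ^ 'n"
    and T :: "'m \<Rightarrow> real ^ 'n" and \<nu> :: "'m \<Rightarrow> real"
  assumes c: "c \<in> {1, -1}"
    and hyp: "hypersurface c X \<A> g f \<eta>"
    and shape: "is_shape_operator c X \<A> f \<eta> A"
    and vert: "vertical_decomposition X \<A> f \<eta> T \<nu>"
    and const: "constant_principal_curvatures X A"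
    and \<nu>_nz: "\<forall>p\<in>topspace X. \<nu> p \<noteq> 0"
begin

lemma atlas: "smooth_atlas X \<A>"
  and smooth_f: "smooth_map \<A> f" and smooth_\<eta>: "smooth_map \<A> \<eta>"
  and bilinear_g: "p \<in> topspace X \<Longrightarrow> bilinear (g p)"
  and g_commute: "p \<in> topspace X \<Longrightarrow> g p u v = g p v u"
  and g_pos: "p \<in> topspace X \<Longrightarrow> v \<noteq> 0 \<Longrightarrow> 0 < g p v v"
  and f_space_form: "p \<in> topspace X \<Longrightarrow> qform c (fst (f p)) (fst (f p)) = c"
  and isometric: "p \<in> topspace X \<Longrightarrow>
    ambient_metric c (differential \<A> f p u) (differential \<A> f p v) = g p u v"
  and \<eta>_tangent: "p \<in> topspace X \<Longrightarrow> qform c (fst (f p)) (fst (\<eta> p)) = 0"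
  and \<eta>_unit: "p \<in> topspace X \<Longrightarrow> ambient_metric c (\<eta> p) (\<eta> p) = 1"
  and \<eta>_normal: "p \<in> topspace X \<Longrightarrow> ambient_metric c (\<eta> p) (differential \<A> f p v) = 0"
  using hyp
  by (auto simp: hypersurface_def connected_smooth_manifold_def riemannian_metric_def
      isometric_immersion_def unit_normal_field_def space_form_def ambient_tangent_def mem_Times_iff)

lemma is_chart_atlas: "a \<in> \<A> \<Longrightarrow> is_chart X a"
  using atlas by (simp add: smooth_atlas_def)

text \<open>The differential of \<open>f\<close> factors through \<open>to_chart\<close> and is
  injective, as it is isometric for a positive definite metric. Surjectivity follows by equality of
  dimensions.\<close>

lemma to_chart_inj_surj:
  assumes a: "a \<in> \<A>" "q \<in> chart_dom a"
  shows "inj (to_chart \<A> a q)" "surj (to_chart \<A> a q)"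
proof -
  have q: "q \<in> topspace X" using a is_chart_atlas chart_dom_subset by blast
  have lin: "linear (to_chart \<A> a q)" by (rule linear_to_chart[OF atlas a])
  show "inj (to_chart \<A> a q)"
    unfolding linear_injective_0[OF lin]
  proof (intro allI impI)
    fix v assume v: "to_chart \<A> a q v = 0"
    have "differential \<A> f q v = differential \<A> f q 0"
      unfolding differential_to_chart[OF atlas a smooth_f] v linear_0[OF lin] ..
    then have "g q v v = g q 0 0" using isometric[OF q] by metis
    then show "v = 0"
      using g_pos[OF q, of v] bilinear_lzero[OF bilinear_g[OF q], of 0] by (cases "v = 0") auto
  qed
  then show "surj (to_chart \<A> a q)"
    using linear_injective_imp_surjective[OF lin] by simp
qed

lemma parametrized_hypersurface_chart:
  assumes a: "a \<in> \<A>"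
  shows "parametrized_hypersurface c (chart_map a ` chart_dom a) (f \<circ> chart_inv a) (\<eta> \<circ> chart_inv a)"
proof
  show "c * c = 1" using c by auto
  show "open (chart_map a ` chart_dom a)" using is_chart_atlas[OF a] by (simp add: is_chart_def)
  show "smooth_on (chart_map a ` chart_dom a) (f \<circ> chart_inv a)"
    "smooth_on (chart_map a ` chart_dom a) (\<eta> \<circ> chart_inv a)"
    using a smooth_f smooth_\<eta> by (simp_all add: smooth_map_def)
next
  fix y v assume y: "y \<in> chart_map a ` chart_dom a"
  define q where "q = chart_inv a y"
  have qa: "q \<in> chart_dom a" and qy: "chart_map a q = y"
    using y by (simp_all add: q_def chart_inv_in_dom chart_map_chart_inv)
  have q: "q \<in> topspace X" using qa chart_dom_subset[OF is_chart_atlas[OF a]] by blast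
  show "qform c (fst ((f \<circ> chart_inv a) y)) (fst ((f \<circ> chart_inv a) y)) = c"
    "qform c (fst ((f \<circ> chart_inv a) y)) (fst ((\<eta> \<circ> chart_inv a) y)) = 0"
    using f_space_form[OF q] \<eta>_tangent[OF q] by (simp_all add: q_def)
  \<comment> \<open>Normality is known for components in the preferred chart of \<open>q\<close>;
    surjectivity of \<open>to_chart\<close> reaches every vector \<open>v\<close> of the chart
    \<open>a\<close>.\<close>
  obtain u where "v = to_chart \<A> a q u" using to_chart_inj_surj(2)[OF a qa] by blast
  then have "differential \<A> f q u = frechet_derivative (f \<circ> chart_inv a) (at y) v"
    using differential_to_chart[OF atlas a qa smooth_f] qy by simp
  then show "ambient_metric c ((\<eta> \<circ> chart_inv a) y) (frechet_derivative (f \<circ> chart_inv a) (at y) v) = 0"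
    using \<eta>_normal[OF q, of u] by (simp add: q_def)
qed

end

text \<open>The chart is the preferred one at \<open>p\<close>, so \<open>DF x\<close> and
  \<open>DN x\<close> are the differentials at \<open>p\<close> without any change of
  components.\<close>

locale hypersurface_chart_at = constant_principal_curvature_hypersurface c X \<A> g f \<eta> A T \<nu>
  for c and X :: "'m topology" and \<A> :: "('m, 'n::finite) chart set" and g f \<eta> A T \<nu> +
  fixes p a x U F N
  assumes p: "p \<in> topspace X"
    and a_def: "a = chart_at \<A> p" and x_def: "x = chart_map a p"
    and U_def: "U = chart_map a ` chart_dom a"
    and F_def: "F = f \<circ> chart_inv a" and N_def: "N = \<eta> \<circ> chart_inv a"
begin

lemma a: "a \<in> \<A>" "p \<in> chart_dom a"
  unfolding a_def by (rule chart_at_works[OF atlas p])+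

sublocale parametrized_hypersurface c U F N
  unfolding U_def F_def N_def by (rule parametrized_hypersurface_chart[OF a(1)])

lemma x: "x \<in> U" using a by (simp add: x_def U_def)

lemma Fx: "F x = f p" and Nx: "N x = \<eta> p"
  using chart_inv_chart_map[OF is_chart_atlas[OF a(1)] a(2)] by (simp_all add: F_def N_def x_def)

lemma DF: "DF x = differential \<A> f p" and DN: "DN x = differential \<A> \<eta> p"
  by (simp_all add: differential_def F_def N_def x_def a_def)

lemma weingarten: "DF x (A p v) = - tangent_proj c (F x) (DN x v)"
  using shape p unfolding is_shape_operator_def covariant_derivative_def Fx DF DN by blast

lemma DF_eq_0_iff: "DF x v = 0 \<longleftrightarrow> v = 0"
proof
  assume "DF x v = 0"
  then have "ambient_metric c (DF x v) (DF x v) = 0"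
    by (simp only: bilinear_lzero[OF bilinear_ambient_metric])
  then have "g p v v = 0" using isometric[OF p, of v v] by (simp only: DF)
  then show "v = 0" using g_pos[OF p, of v] by (cases "v = 0") auto
qed (simp add: linear_0[OF linear_DF[OF x]])

lemma DF_eq_iff: "DF x v = DF x w \<longleftrightarrow> v = w"
  using DF_eq_0_iff[of "v - w"] by (simp add: linear_diff[OF linear_DF[OF x]])

text \<open>The shape operator is given only through the Weingarten formula; its linearity comes
  from that of the right-hand side and injectivity of \<open>DF x\<close>.\<close>

lemma linear_A: "linear (A p)"
proof (rule linearI)
  fix u v r
  have "DF x (A p (u + v)) = DF x (A p u + A p v)"
    by (simp add: weingarten linear_add[OF linear_DF[OF x]] linear_add[OF linear_DN[OF x]]
        linear_add[OF linear_tangent_proj])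
  then show "A p (u + v) = A p u + A p v" by (simp only: DF_eq_iff)
  have "DF x (A p (r *\<^sub>R v)) = DF x (r *\<^sub>R A p v)"
    by (simp add: weingarten linear_scale[OF linear_DF[OF x]] linear_scale[OF linear_DN[OF x]]
        linear_scale[OF linear_tangent_proj])
  then show "A p (r *\<^sub>R v) = r *\<^sub>R A p v" by (simp only: DF_eq_iff)
qed

lemma g_A: "g p (A p v) w = - ambient_metric c (DN x v) (DF x w)"
proof -
  have "g p (A p v) w = ambient_metric c (DF x (A p v)) (DF x w)"
    using isometric[OF p] by (simp only: DF)
  also have "\<dots> = - ambient_metric c (tangent_proj c (F x) (DN x v)) (DF x w)"
    by (simp only: weingarten bilinear_lneg[OF bilinear_ambient_metric])
  also have "\<dots> = - ambient_metric c (DN x v) (DF x w)"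
    by (simp only: ambient_metric_tangent_proj[OF qform_F_DF[OF x]])
  finally show ?thesis .
qed

lemma A_self_adjoint: "g p (A p v) w = g p v (A p w)"
  using g_A[of v w] g_A[of w v] second_fundamental_form_commute[OF x, of v w] g_commute[OF p, of v "A p w"]
  by simp

lemma shape_form_at: "shape_form l x v w = g p (l *\<^sub>R v - A p v) w"
proof -
  have "shape_form l x v w = ambient_metric c (DN x v) (DF x w) + l * ambient_metric c (DF x v) (DF x w)"
    unfolding shape_form_def
    by (simp only: bilinear_ladd[OF bilinear_ambient_metric] bilinear_lmul[OF bilinear_ambient_metric])
      simp
  also have "ambient_metric c (DF x v) (DF x w) = g p v w" using isometric[OF p] by (simp only: DF)
  also have "ambient_metric c (DN x v) (DF x w) = - g p (A p v) w" by (simp add: g_A)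
  finally show ?thesis
    by (simp add: bilinear_lsub[OF bilinear_g[OF p]] bilinear_lmul[OF bilinear_g[OF p]])
qed

lemma shape_form_kernel_at: "{v. \<forall>w. shape_form l x v w = 0} = {v. A p v = l *\<^sub>R v}"
proof (intro equalityI subsetI CollectI allI; drule CollectD)
  fix v assume "\<forall>w. shape_form l x v w = 0"
  \<comment> \<open>The form is tested on the residual \<open>l *\<^sub>R v - A p v\<close>
    itself.\<close>
  then have "g p (l *\<^sub>R v - A p v) (l *\<^sub>R v - A p v) = 0" by (simp add: shape_form_at)
  then show "A p v = l *\<^sub>R v" using g_pos[OF p, of "l *\<^sub>R v - A p v"] by force
next
  fix v w assume "A p v = l *\<^sub>R v"
  then show "shape_form l x v w = 0" by (simp add: shape_form_at bilinear_lzero[OF bilinear_g[OF p]])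
qed

text \<open>The chart \<open>a\<close> need not be the preferred one at \<open>q\<close>, so the
  eigenspace at \<open>q\<close> is carried over by the injective map \<open>to_chart\<close>, which
  keeps its dimension. Its image lies in the kernel at \<open>y\<close>, and constant multiplicity
  compares it with the eigenspace at \<open>p\<close>.\<close>

lemma shape_form_kernel_ge:
  assumes l: "l \<in> principal_curvatures A p" and y: "y \<in> U"
  shows "dim {v. \<forall>w. shape_form l x v w = 0} \<le> dim {v. \<forall>w. shape_form l y v w = 0}"
proof -
  define q where "q = chart_inv a y"
  have qa: "q \<in> chart_dom a" and qy: "chart_map a q = y"
    using y by (simp_all add: q_def U_def chart_inv_in_dom chart_map_chart_inv)
  have q: "q \<in> topspace X" using qa chart_dom_subset[OF is_chart_atlas[OF a(1)]] by blast
  define E where "E = {v. A q v = l *\<^sub>R v}"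
  have "pc_multiplicity A p l = pc_multiplicity A q l"
    using const l p q unfolding constant_principal_curvatures_def by blast
  then have "dim {v. \<forall>w. shape_form l x v w = 0} = dim E"
    by (simp only: shape_form_kernel_at E_def pc_multiplicity_def)
  also have "\<dots> = dim (to_chart \<A> a q ` E)"
    by (rule dim_image_eq[OF linear_to_chart[OF atlas a(1) qa]
          inj_on_subset[OF to_chart_inj_surj(1)[OF a(1) qa] subset_UNIV], symmetric])
  also have "\<dots> \<le> dim {v. \<forall>w. shape_form l y v w = 0}"
  proof (intro dim_subset subsetI CollectI allI)
    fix v w assume "v \<in> to_chart \<A> a q ` E"
    then obtain u where u: "A q u = l *\<^sub>R u" and v: "v = to_chart \<A> a q u" by (auto simp: E_def)
    have d: "DF y v = differential \<A> f q u" "DN y v = differential \<A> \<eta> q u"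
      using differential_to_chart[OF atlas a(1) qa smooth_f] differential_to_chart[OF atlas a(1) qa smooth_\<eta>]
      by (simp_all add: v qy F_def N_def)
    have "differential \<A> f q (l *\<^sub>R u) = l *\<^sub>R DF y v"
      using differential_to_chart[OF atlas a(1) qa smooth_f]
      by (simp add: v qy F_def[symmetric] linear_scale[OF linear_to_chart[OF atlas a(1) qa]] linear_scale[OF linear_DF[OF y]])
    moreover have "differential \<A> f q (A q u) = - tangent_proj c (F y) (DN y v)"
      using shape q by (simp add: is_shape_operator_def covariant_derivative_def d F_def q_def)
    ultimately have "l *\<^sub>R DF y v = - tangent_proj c (F y) (DN y v)" by (simp add: u)
    then have "shape_form l y v w = ambient_metric c (DN y v) (DF y w)
        - ambient_metric c (tangent_proj c (F y) (DN y v)) (DF y w)"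
      unfolding shape_form_def by (simp add: bilinear_lsub[OF bilinear_ambient_metric])
    then show "shape_form l y v w = 0"
      by (simp add: ambient_metric_tangent_proj[OF qform_F_DF[OF y]])
  qed
  finally show ?thesis .
qed

section \<open>The tangential and normal parts of the vertical field\<close>

lemma vertical_eq: "vertical_field = DF x (T p) + \<nu> p *\<^sub>R N x"
  using vert p unfolding vertical_decomposition_def DF Nx by blast

text \<open>Pairing with the vertical field reads off the last coordinate, and its normal part
  contributes nothing. Thus vanishing of \<open>snd (DF x v)\<close> means orthogonality of
  \<open>v\<close> to \<open>T p\<close>.\<close>

lemma snd_DF: "snd (DF x v) = g p (T p) v"
proof -
  have "snd (DF x v) = ambient_metric c vertical_field (DF x v)"
    by (simp add: vertical_field_def ambient_metric_def qform_def)
  also have "\<dots> = ambient_metric c (DF x (T p)) (DF x v)"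
    unfolding vertical_eq
    by (simp only: bilinear_ladd[OF bilinear_ambient_metric] bilinear_lmul[OF bilinear_ambient_metric] normal[OF x])
      simp
  also have "\<dots> = g p (T p) v" using isometric[OF p] by (simp only: DF)
  finally show ?thesis .
qed

lemma snd_N: "snd (N x) = \<nu> p"
proof -
  have "snd (N x) = ambient_metric c (N x) vertical_field"
    by (simp add: vertical_field_def ambient_metric_def qform_def)
  also have "\<dots> = \<nu> p * ambient_metric c (\<eta> p) (\<eta> p)"
    unfolding vertical_eq Nx
    by (simp only: bilinear_radd[OF bilinear_ambient_metric] bilinear_rmul[OF bilinear_ambient_metric]
        normal[OF x, unfolded Nx]) simp
  finally show ?thesis using \<eta>_unit[OF p] by simp
qed

lemma T_orthogonal_eigenspace:
  assumes l: "2 \<le> pc_multiplicity A p l" and v: "A p v = l *\<^sub>R v"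
  shows "g p (T p) v = 0"
proof (cases "v = 0")
  case True
  then show ?thesis by (simp add: bilinear_rzero[OF bilinear_g[OF p]])
next
  case False
  then have "l \<in> principal_curvatures A p" using v by (auto simp: principal_curvatures_def)
  have "snd (DF x v) = 0"
  proof (rule vertical_part_zero_on_eigenspace[OF x, where E = "{v. A p v = l *\<^sub>R v}"])
    show "0 < ambient_metric c (DF x v) (DF x v)" if "v \<noteq> 0" for v
      using isometric[OF p, of v v] g_pos[OF p that] by (simp only: DF)
    show "dim {v. \<forall>w. shape_form l x v w = 0} \<le> dim {v. \<forall>w. shape_form l y v w = 0}" if "y \<in> U" for y
      by (rule shape_form_kernel_ge) fact+
    show "subspace {v. A p v = l *\<^sub>R v}"
      by (auto simp: subspace_def linear_0[OF linear_A] linear_add[OF linear_A] linear_scale[OF linear_A]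
          algebra_simps)
    show "2 \<le> dim {v. A p v = l *\<^sub>R v}" using l by (simp add: pc_multiplicity_def)
    show "tangent_proj c (F x) (DN x v) = - (l *\<^sub>R DF x v)" if "v \<in> {v. A p v = l *\<^sub>R v}" for v
      using weingarten[of v] that by (simp add: linear_scale[OF linear_DF[OF x]] minus_equation_iff[of "l *\<^sub>R _"])
    show "snd (N x) \<noteq> 0" using \<nu>_nz p by (simp only: snd_N) blast
  qed (use v in simp)
  then show ?thesis by (simp only: snd_DF)
qed

text \<open>The orthogonal complement \<open>W\<close> of all eigenvectors is invariant under
  \<open>A p\<close> and contains \<open>T p\<close>. Were \<open>T p\<close> nonzero,
  \<open>W\<close> would contain an eigenvector, orthogonal to itself.\<close>

lemma T_zero:
  assumes "\<And>l. l \<in> principal_curvatures A p \<Longrightarrow> 2 \<le> pc_multiplicity A p l"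
  shows "T p = 0"
proof (rule ccontr)
  assume "T p \<noteq> 0"
  note bg = bilinear_g[OF p]
  define S where "S = {v. \<exists>l. A p v = l *\<^sub>R v}"
  define W where "W = {w. \<forall>v\<in>S. g p w v = 0}"
  have W: "subspace W"
    by (simp add: W_def subspace_def bilinear_lzero[OF bg] bilinear_ladd[OF bg] bilinear_lmul[OF bg])
  have AW: "A p w \<in> W" if "w \<in> W" for w
    using that by (auto simp: W_def S_def A_self_adjoint bilinear_rmul[OF bg])
  have TW: "T p \<in> W"
  proof -
    have "g p (T p) v = 0" if "A p v = l *\<^sub>R v" for l v
    proof (cases "v = 0")
      case True
      then show ?thesis by (simp add: bilinear_rzero[OF bg])
    next
      case False
      then have "l \<in> principal_curvatures A p" using that by (auto simp: principal_curvatures_def)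
      then show ?thesis using T_orthogonal_eigenspace assms that by blast
    qed
    then show ?thesis by (auto simp: W_def S_def)
  qed
  obtain l v where v: "v \<in> W" "v \<noteq> 0" "A p v = l *\<^sub>R v"
    using self_adjoint_invariant_subspace_eigenvector[OF bg g_commute[OF p] g_pos[OF p] linear_A
        A_self_adjoint W AW TW \<open>T p \<noteq> 0\<close>]
    by blast
  then have "g p v v = 0" by (auto simp: W_def S_def)
  then show False using g_pos[OF p v(2)] by simp
qed

lemma vertical_field_normal: "T p = 0 \<Longrightarrow> vertical_field = \<nu> p *\<^sub>R \<eta> p"
  using vertical_eq by (simp add: linear_0[OF linear_DF[OF x]] Nx)

text \<open>A vertical normal has no component along the space form, and this holds throughout the
  chart, so it may be differentiated. Unit length kills the remaining vertical component of
  \<open>DN x v\<close>, and the Weingarten formula then gives zero.\<close>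

lemma A_zero:
  assumes vertical: "\<And>q. q \<in> topspace X \<Longrightarrow> vertical_field = \<nu> q *\<^sub>R \<eta> q"
  shows "A p v = 0"
proof -
  have q: "chart_inv a y \<in> topspace X" if "y \<in> U" for y
    using that chart_inv_in_dom[of y a] chart_dom_subset[OF is_chart_atlas[OF a(1)]]
    unfolding U_def by blast
  have fst_N: "fst (N y) = 0" if "y \<in> U" for y
  proof -
    have "\<nu> (chart_inv a y) *\<^sub>R fst (N y) = fst (vertical_field :: 'n ambient)"
      by (subst vertical[OF q[OF that]]) (simp add: N_def)
    then show ?thesis using \<nu>_nz q[OF that] by (simp add: vertical_field_def zero_prod_def[symmetric])
  qed
  have "((\<lambda>y. fst (N y)) has_derivative (\<lambda>v. fst (DN x v))) (at x)"
    by (rule has_derivative_fst[OF has_DN[OF x]])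
  moreover have "((\<lambda>y. fst (N y)) has_derivative (\<lambda>v. 0)) (at x)"
    by (rule has_derivative_transform_within_open[OF has_derivative_const U x]) (simp add: fst_N)
  ultimately have fst_DN: "fst (DN x v) = 0" by (metis has_derivative_unique)
  have "ambient_metric c (N x) (DN x v) + ambient_metric c (DN x v) (N x) = 0"
    by (rule constant_pairing_derivative[OF bilinear_ambient_metric U x has_DN[OF x] has_DN[OF x]])
      (use \<eta>_unit q in \<open>simp add: N_def\<close>)
  then have "snd (N x) * snd (DN x v) = 0"
    by (simp add: ambient_metric_def qform_def fst_DN)
  moreover have "snd (N x) \<noteq> 0" using \<nu>_nz p by (simp add: snd_N)
  ultimately have "DN x v = 0" using fst_DN by (simp add: prod_eq_iff)
  then have "DF x (A p v) = 0" by (simp add: weingarten linear_0[OF linear_tangent_proj])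
  then show ?thesis by (simp only: DF_eq_0_iff)
qed

end

section \<open>The contradiction from the absence of a simple principal curvature\<close>

theorem theorem7p1:
  fixes c :: real
    and X :: "'m topology"
    and \<A> :: "('m, 'n::finite) chart set"
    and g :: "'m \<Rightarrow> real ^ 'n \<Rightarrow> real ^ 'n \<Rightarrow> real"
    and f \<eta> :: "'m \<Rightarrow> 'n ambient"
    and A :: "'m \<Rightarrow> real ^ 'n \<Rightarrow> real ^ 'n"
    and T :: "'m \<Rightarrow> real ^ 'n"
    and \<nu> :: "'m \<Rightarrow> real"
  assumes "c \<in> {1, -1}"
    and "CARD('n) \<ge> 2"
    and "hypersurface c X \<A> g f \<eta>"
    and "is_shape_operator c X \<A> f \<eta> A"
    and "vertical_decomposition X \<A> f \<eta> T \<nu>"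
    and "constant_principal_curvatures X A"
    and "non_umbilical X A"
    and "\<forall>p\<in>topspace X. \<nu> p \<noteq> 0"
  shows "\<exists>l. \<forall>p\<in>topspace X. l \<in> principal_curvatures A p \<and> pc_multiplicity A p l = 1"
proof (rule ccontr)
  assume no_simple: "\<not> ?thesis"
  have const: "principal_curvatures A p = principal_curvatures A q"
    "l \<in> principal_curvatures A p \<Longrightarrow> pc_multiplicity A p l = pc_multiplicity A q l"
    if "p \<in> topspace X" "q \<in> topspace X" for p q l
    using assms(6) that unfolding constant_principal_curvatures_def by blast+
  have mult: "2 \<le> pc_multiplicity A p l"
    if p: "p \<in> topspace X" and l: "l \<in> principal_curvatures A p" for p l
  proof -
    \<comment> \<open>The point where \<open>l\<close> fails to be simple may differ from
      \<open>p\<close>; constancy carries the failure back to \<open>p\<close>.\<close>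
    obtain q where q: "q \<in> topspace X" "\<not> (l \<in> principal_curvatures A q \<and> pc_multiplicity A q l = 1)"
      using no_simple by blast
    then have "pc_multiplicity A p l \<noteq> 1" using const(1)[OF p q(1)] const(2)[OF p q(1) l] l by simp
    moreover obtain v where "v \<noteq> 0" "A p v = l *\<^sub>R v" using l by (auto simp: principal_curvatures_def)
    then have "\<not> {v. A p v = l *\<^sub>R v} \<subseteq> {0}" by blast
    then have "pc_multiplicity A p l \<noteq> 0" unfolding pc_multiplicity_def by (metis dim_eq_0)
    ultimately show ?thesis by linarith
  qed
  have chart: "hypersurface_chart_at c X \<A> g f \<eta> A T \<nu> p (chart_at \<A> p) (chart_map (chart_at \<A> p) p)
      (chart_map (chart_at \<A> p) ` chart_dom (chart_at \<A> p)) (f \<circ> chart_inv (chart_at \<A> p))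
      (\<eta> \<circ> chart_inv (chart_at \<A> p))" if "p \<in> topspace X" for p
    by unfold_locales (use assms that in auto)
  have vertical: "vertical_field = \<nu> p *\<^sub>R \<eta> p" if p: "p \<in> topspace X" for p
    by (rule hypersurface_chart_at.vertical_field_normal[OF chart[OF p]
          hypersurface_chart_at.T_zero[OF chart[OF p] mult[OF p]]])
  obtain p where p: "p \<in> topspace X"
    using assms(3) unfolding hypersurface_def connected_smooth_manifold_def by blast
  have "A p v = 0" for v by (rule hypersurface_chart_at.A_zero[OF chart[OF p] vertical])
  then have "principal_curvatures A p \<subseteq> {0}" by (auto simp: principal_curvatures_def)
  then have "card (principal_curvatures A p) \<le> card {0 :: real}" by (intro card_mono) auto
  moreover have "2 \<le> card (principal_curvatures A p)" using assms(7) p by (simp add: non_umbilical_def)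
  ultimately show False by simp
qed

end
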